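(* Let $1\le q<\infty$. There exists a constant $C(q)>0$, depending only on $q$, such that the following holds. Let $\Omega$ be a compact subset of some $\mathbb{R}^d$, let $\mu$ be a probability measure on $\Omega$, let $X_N$ be an $N$-dimensional linear subspace of functions on $\Omega$ ($N\ge 1$), put $X_N^q:=\{f\in X_N:\ \|f\|_q\le 1\}$, and suppose that for some $B\ge 1$ $$ \varepsilon_k(X_N^q,L_\infty)\le B\,(N/k)^{1/q},\qquad 1\le k\le N . $$ Then there exist a positive integer $$ m\le C(q)\,N B^{q}\,(\log_2(2BN))^2 $$ and points $\xi^1,\dots,\xi^m\in\Omega$ such that for every $f\in X_N$ $$ \frac12\|f\|_q^q\le \frac1m\sum_{j=1}^m |f(\xi^j)|^q\le \frac32\|f\|_q^q . $$
   Context: For $1\le q<\infty$, $\|f\|_q:=\left(\int_\Omega |f|^q\,d\mu\right)^{1/q}$. $L_\infty$ denotes the space of continuous functions on $\Omega$ with the uniform norm $\|f\|_\infty=\max_{x\in\Omega}|f(x)|$; $X_N$ is a subspace of continuous functions. Entropy numbers: let $(X,\|\cdot\|)$ be a Banach space and $B_X(f,r):=\{g\in X:\|f-g\|\le r\}$. For a compact set $A\subset X$ and $\varepsilon>0$, $$N_\varepsilon(A,X):=\min\Big\{n:\ \exists f_1,\dots,f_n\in A,\ A\subseteq\bigcup_{j=1}^n B_X(f_j,\varepsilon)\Big\}$$ (centers are required to lie in $A$), $\mathcal{H}_\varepsilon(A,X):=\log_2 N_\varepsilon(A,X)$, and $$\varepsilon_k(A,X):=\inf\{\varepsilon>0:\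 \mathcal{H}_\varepsilon(A,X)\le k\},\qquad k=1,2,\dots.$$ *)

theory Defs
  imports
    "HOL-Analysis.Analysis"
    "HOL-Probability.Probability"
    "HOL-Library.Function_Algebras"
begin

definition fun_scale :: "'k::field \<Rightarrow> ('a \<Rightarrow> 'k) \<Rightarrow> ('a \<Rightarrow> 'k)"
  where "fun_scale c f = (\<lambda>x. c * f x)"

(* Functions 'a => 'k as a vector space over 'k; this provides fun_vs.subspace and fun_vs.dim. *)
global_interpretation fun_vs: vector_space "fun_scale :: 'k::field \<Rightarrow> ('a \<Rightarrow> 'k) \<Rightarrow> ('a \<Rightarrow> 'k)"
  by unfold_locales (auto simp: fun_scale_def algebra_simps)

(* C(Omega).  A function on Omega is represented by its extension by zero to the whole type, so
   that two elements are equal iff they agree on Omega and dimensions are those of spaces of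
   functions on Omega. *)
definition cont_functions :: "'a::topological_space set \<Rightarrow> ('a \<Rightarrow> 'k::real_normed_field) set"
  where "cont_functions \<Omega> = {f. continuous_on \<Omega> f \<and> (\<forall>x. x \<notin> \<Omega> \<longrightarrow> f x = 0)}"

(* For f in C(Omega) with Omega compact and nonempty the supremum is attained. *)
definition sup_norm :: "'a set \<Rightarrow> ('a \<Rightarrow> 'k::real_normed_field) \<Rightarrow> real"
  where "sup_norm \<Omega> f = (SUP x\<in>\<Omega>. norm (f x))"

definition Lq_norm :: "'a measure \<Rightarrow> real \<Rightarrow> ('a \<Rightarrow> 'k::real_normed_field) \<Rightarrow> real"
  where "Lq_norm \<mu> q f = (\<integral>x. norm (f x) powr q \<partial>\<mu>) powr (1 / q)"

definition Lq_unit_ball ::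
    "'a measure \<Rightarrow> real \<Rightarrow> ('a \<Rightarrow> 'k::real_normed_field) set \<Rightarrow> ('a \<Rightarrow> 'k) set"
  where "Lq_unit_ball \<mu> q X = {f \<in> X. Lq_norm \<mu> q f \<le> 1}"

(* A normed space is given by its carrier X and its norm nrm. *)
definition normed_ball :: "'v::minus set \<Rightarrow> ('v \<Rightarrow> real) \<Rightarrow> 'v \<Rightarrow> real \<Rightarrow> 'v set"
  where "normed_ball X nrm f r = {g \<in> X. nrm (f - g) \<le> r}"

(* The value is infinite if no finite cover exists, because the infimum is taken in enat. *)
definition covering_number ::
    "real \<Rightarrow> 'v::minus set \<Rightarrow> 'v set \<Rightarrow> ('v \<Rightarrow> real) \<Rightarrow> enat"
  where "covering_number \<epsilon> A X nrm =
    Inf {enat n | n. \<exists>f :: nat \<Rightarrow> 'v. (\<forall>j\<in>{1..n}. f j \<in> A) \<and>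
                        A \<subseteq> (\<Union>j\<in>{1..n}. normed_ball X nrm (f j) \<epsilon>)}"

definition metric_entropy ::
    "real \<Rightarrow> 'v::minus set \<Rightarrow> 'v set \<Rightarrow> ('v \<Rightarrow> real) \<Rightarrow> ereal"
  where "metric_entropy \<epsilon> A X nrm =
    (case covering_number \<epsilon> A X nrm of enat n \<Rightarrow> ereal (log 2 (real n)) | \<infinity> \<Rightarrow> \<infinity>)"

(* Extended-real valued, so that the infimum of the empty set is infinity and an upper bound on
   an entropy number cannot hold vacuously. *)
definition entropy_number ::
    "nat \<Rightarrow> 'v::minus set \<Rightarrow> 'v set \<Rightarrow> ('v \<Rightarrow> real) \<Rightarrow> ereal"
  where "entropy_number k A X nrm =
    Inf {ereal \<epsilon> | \<epsilon>. \<epsilon> > 0 \<and> metric_entropy \<epsilon> A X nrm \<le> ereal (real k)}"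

(* mu is a Borel probability measure on the compact set Omega in R^d, X is an N-dimensional
   subspace of C(Omega) over the scalar field 'k, and the entropy numbers of its L_q unit ball in
   the uniform norm satisfy the stated decay. R^d is Euclidean_space d, whose points are the
   sequences vanishing from index d on, so that d is an ordinary variable. The topology of
   Euclidean_space d is the one induced from the type nat => real, hence continuity and Borel sets
   on Omega are those of that type. *)
definition entropy_setting ::
    "real \<Rightarrow> nat \<Rightarrow> (nat \<Rightarrow> real) set \<Rightarrow> (nat \<Rightarrow> real) measure
      \<Rightarrow> ((nat \<Rightarrow> real) \<Rightarrow> 'k::real_normed_field) set \<Rightarrow> nat \<Rightarrow> real \<Rightarrow> bool"
  where "entropy_setting q d \<Omega> \<mu> X N B \<longleftrightarrow>
    compactin (Euclidean_space d) \<Omega> \<and>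
    prob_space \<mu> \<and> sets \<mu> = sets (restrict_space borel \<Omega>) \<and>
    X \<subseteq> cont_functions \<Omega> \<and> fun_vs.subspace X \<and> fun_vs.dim X = N \<and> N \<ge> 1 \<and>
    B \<ge> 1 \<and>
    (\<forall>k\<in>{1..N}. entropy_number k (Lq_unit_ball \<mu> q X) (cont_functions \<Omega>) (sup_norm \<Omega>)
                   \<le> ereal (B * (real N / real k) powr (1 / q)))"

end

theory Submission
  imports Defs
begin

text \<open>
  The function \<open>\<bar>f\<bar> powr q\<close> is cut into dyadic layers according to the size of \<open>\<bar>f\<bar>\<close>. In the layer at
  level \<open>t\<close>, replacing \<open>f\<close> by the nearest element of a net of mesh \<open>a * t\<close> in the uniform norm changes
  the layer by a small multiple of \<open>t powr q\<close>, and only where \<open>\<bar>f\<bar>\<close> is at least of order \<open>t\<close>; so for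
  small \<open>a\<close> the errors of all layers add up to at most \<open>\<bar>f\<bar> powr q / 16\<close>. It remains to discretize
  finitely many functions per layer. A layer is bounded by \<open>t powr q\<close> and has integral at most 1, so
  a Bernstein bound applies with a number of points of order \<open>t powr q\<close> times the entropy of the net,
  which is of order \<open>N * B powr q\<close> by hypothesis; the two logarithms come from requiring a precision
  inversely proportional to the number of layers. For meshes below \<open>2 * B\<close> the hypothesis says
  nothing, and a crude net built from an orthonormal basis suffices, because the factors
  \<open>t powr q\<close> then form a geometric series.
\<close>

section \<open>Sampling a finite family\<close>

text \<open>With \<open>l\<close> the parameter of the Bernstein bound, a layer deviates by at most
  \<open>l\<close> plus its entropy cost divided by \<open>m * l\<close>. Over \<open>J\<close>
  layers the first terms force \<open>l\<close> to be of order \<open>1 / J\<close>. The costs sum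
  to order \<open>L * N * B powr q\<close> with \<open>L = log 2 (2 * B * N)\<close>, and
  \<open>J\<close> is of order \<open>L\<close>, whence the size of \<open>m\<close>. That so few
  layers suffice follows from the entropy hypothesis at \<open>k = 1\<close>, which bounds the
  uniform norm on the unit ball by a multiple of \<open>B * N powr (1 / q)\<close>; higher layers
  vanish. Since each level has its own net element, the sum of the replaced layers is not the power
  of one function. It only has to be close to \<open>\<bar>f\<bar> powr q\<close> at every point,
  with an error relative to that value. Such an error averages to a fraction of whichever mean is
  taken, integral or sample mean, so both occur in the resulting inequality, which is solved for the
  sample mean after normalizing the integral to 1. Layers depend on the modulus alone, so real and
  complex scalars are treated together, a complex space being viewed as a real one with
  \<open>2 * N\<close> generators.\<close>

lemma (in prob_space) exists_le_expectation:
  fixes h :: "'a \<Rightarrow> real"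
  assumes "integrable M h"
  shows "\<exists>x\<in>space M. h x \<le> expectation h"
proof (rule ccontr)
  assume "\<not> ?thesis"
  then have "AE x in M. expectation h < h x" by (intro AE_I2) auto
  then have "expectation h < expectation h"
    using assms by (intro expectation_greater) auto
  then show False by simp
qed

text \<open>Choosing the points one at a time, each so as not to increase the weighted sum (the method of
  conditional expectations), avoids the product measure.\<close>

lemma (in prob_space) exists_sample:
  fixes G :: "'i \<Rightarrow> 'a \<Rightarrow> real"
  assumes int: "\<And>i. i \<in> I \<Longrightarrow> integrable M (G i)"
    and nonneg: "\<And>i x. i \<in> I \<Longrightarrow> x \<in> space M \<Longrightarrow> 0 \<le> G i x"
    and le1: "\<And>i. i \<in> I \<Longrightarrow> expectation (G i) \<le> 1"
    and w: "\<And>i. i \<in> I \<Longrightarrow> 0 \<le> w i"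
  shows "\<exists>\<xi>. (\<forall>j\<in>{1..m::nat}. \<xi> j \<in> space M) \<and>
    (\<Sum>i\<in>I. w i * (\<Prod>j=1..m. G i (\<xi> j))) \<le> (\<Sum>i\<in>I. w i)"
proof (induction m)
  case 0
  then show ?case by auto
next
  case (Suc m)
  then obtain \<xi> where \<xi>: "\<forall>j\<in>{1..m}. \<xi> j \<in> space M"
    "(\<Sum>i\<in>I. w i * (\<Prod>j=1..m. G i (\<xi> j))) \<le> (\<Sum>i\<in>I. w i)" by blast
  define v where "v i = w i * (\<Prod>j=1..m. G i (\<xi> j))" for i
  have v0: "0 \<le> v i" if "i \<in> I" for i
    unfolding v_def using that \<xi>(1) nonneg w by (intro mult_nonneg_nonneg prod_nonneg) auto
  obtain x where x: "x \<in> space M"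
    "(\<Sum>i\<in>I. v i * G i x) \<le> expectation (\<lambda>x. \<Sum>i\<in>I. v i * G i x)"
    using exists_le_expectation[of "\<lambda>x. \<Sum>i\<in>I. v i * G i x"] int by auto
  have "expectation (\<lambda>x. \<Sum>i\<in>I. v i * G i x) = (\<Sum>i\<in>I. v i * expectation (G i))"
    using int by (subst Bochner_Integration.integral_sum) auto
  also have "\<dots> \<le> (\<Sum>i\<in>I. v i)"
    using v0 le1 by (intro sum_mono mult_left_le) auto
  finally have *: "(\<Sum>i\<in>I. v i * G i x) \<le> (\<Sum>i\<in>I. w i)"
    using x(2) \<xi>(2) unfolding v_def by linarith
  have "(\<Prod>j=1..Suc m. G i ((\<xi>(Suc m := x)) j)) = (\<Prod>j=1..m. G i (\<xi> j)) * G i x" for i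
    by (simp add: prod.nat_ivl_Suc')
  then have "(\<Sum>i\<in>I. w i * (\<Prod>j=1..Suc m. G i ((\<xi>(Suc m := x)) j))) \<le> (\<Sum>i\<in>I. w i)"
    using * by (simp add: v_def mult.assoc)
  moreover have "\<forall>j\<in>{1..Suc m}. (\<xi>(Suc m := x)) j \<in> space M"
    using \<xi>(1) x(1) by auto
  ultimately show ?case by blast
qed

lemma exp_le_quadratic:
  fixes x :: real
  assumes "\<bar>x\<bar> \<le> 1"
  shows "exp x \<le> 1 + x + x\<^sup>2"
proof (cases "0 \<le> x")
  case True
  then show ?thesis using assms exp_bound by auto
next
  case False
  have "0 < 1 - x" "1 - x \<le> exp (- x)"
    using False exp_ge_add_one_self[of "-x"] by auto
  then have "exp x * (1 - x) \<le> 1"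
    using mult_left_mono[of "1 - x" "exp (-x)" "exp x"] by (simp add: exp_minus)
  \<comment> \<open>The product equals \<open>1 - x ^ 3\<close>, and \<open>x\<close> is
    negative.\<close>
  also have "1 \<le> (1 + x + x\<^sup>2) * (1 - x)"
    using False mult_nonneg_nonneg[of "-x" "x\<^sup>2"] by (simp add: algebra_simps power2_eq_square)
  finally show ?thesis using \<open>0 < 1 - x\<close> by simp
qed

lemma (in prob_space) integrable_abs_le_const:
  fixes \<phi> :: "'a \<Rightarrow> real"
  assumes "\<phi> \<in> borel_measurable M" "\<And>x. x \<in> space M \<Longrightarrow> \<bar>\<phi> x\<bar> \<le> b"
  shows "integrable M \<phi>"
  using assms by (intro integrable_const_bound[where B = b]) auto

lemma (in prob_space) exponential_moment_le:
  fixes \<phi> :: "'a \<Rightarrow> real"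
  assumes meas: "\<phi> \<in> borel_measurable M"
    and bd: "\<And>x. x \<in> space M \<Longrightarrow> 0 \<le> \<phi> x \<and> \<phi> x \<le> 1"
    and l: "\<bar>l\<bar> \<le> 1"
  defines "p \<equiv> expectation \<phi>"
  shows "integrable M (\<lambda>x. exp (l * (\<phi> x - p) - l\<^sup>2 * p))"
    and "expectation (\<lambda>x. exp (l * (\<phi> x - p) - l\<^sup>2 * p)) \<le> 1"
proof -
  have i1: "integrable M \<phi>"
    using bd by (intro integrable_abs_le_const[where b = 1] meas) (auto simp: abs_le_iff)
  have i2: "integrable M (\<lambda>x. (\<phi> x)\<^sup>2)"
    using bd meas by (intro integrable_abs_le_const[where b = 1]) (auto simp: abs_le_iff power_le_one)
  have p: "0 \<le> p" "p \<le> 1"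
    unfolding p_def using bd i1 integral_mono[OF i1, of "\<lambda>_. 1"]
    by (auto intro!: integral_nonneg_AE simp: prob_space)
  have small: "\<bar>l * (\<phi> x - p)\<bar> \<le> 1" if "x \<in> space M" for x
    using bd[OF that] p l by (auto simp: abs_mult intro!: mult_le_one)
  have ie: "integrable M (\<lambda>x. exp (l * (\<phi> x - p)))"
  proof (rule integrable_abs_le_const[where b = "exp 1"])
    show "\<bar>exp (l * (\<phi> x - p))\<bar> \<le> exp 1" if "x \<in> space M" for x
      using small[OF that] by auto
  qed (use meas in measurable)
  then show "integrable M (\<lambda>x. exp (l * (\<phi> x - p) - l\<^sup>2 * p))"
    by (simp add: exp_diff)
  let ?q = "\<lambda>x. 1 + l * (\<phi> x - p) + l\<^sup>2 * ((\<phi> x)\<^sup>2 - 2 * p * \<phi> x + p\<^sup>2)"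
  have "expectation (\<lambda>x. exp (l * (\<phi> x - p))) \<le> expectation ?q"
  proof (rule integral_mono[OF ie])
    show "exp (l * (\<phi> x - p)) \<le> ?q x" if "x \<in> space M" for x
      using exp_le_quadratic[OF small[OF that]]
      by (simp add: power2_eq_square algebra_simps)
  qed (use i1 i2 in auto)
  also have "\<dots> = 1 + l\<^sup>2 * (expectation (\<lambda>x. (\<phi> x)\<^sup>2) - p\<^sup>2)"
    using i1 i2 by (simp add: prob_space p_def power2_eq_square algebra_simps)
  also have "\<dots> \<le> 1 + l\<^sup>2 * p"
  proof -
    have "expectation (\<lambda>x. (\<phi> x)\<^sup>2) \<le> p" unfolding p_def
      using bd by (intro integral_mono i1 i2) (auto simp: power2_eq_square mult_left_le)
    then have "expectation (\<lambda>x. (\<phi> x)\<^sup>2) - p\<^sup>2 \<le> p"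
      by (smt (verit) zero_le_power2)
    then show ?thesis by (simp add: mult_left_mono)
  qed
  also have "\<dots> \<le> exp (l\<^sup>2 * p)" by (rule exp_ge_add_one_self)
  finally show "expectation (\<lambda>x. exp (l * (\<phi> x - p) - l\<^sup>2 * p)) \<le> 1"
    by (simp add: exp_diff)
qed

text \<open>A union bound without probabilities: \<open>w i\<close> is the failure probability
  allotted to \<open>i\<close>, and its price is \<open>ln (1 / w i)\<close>. The weights sum to at
  most one half because each index is used twice, once for each tail.\<close>

lemma (in prob_space) exists_sample_small_deviation:
  fixes \<phi> :: "'i \<Rightarrow> 'a \<Rightarrow> real" and m :: nat
  assumes fin: "finite I"
    and meas: "\<And>i. i \<in> I \<Longrightarrow> \<phi> i \<in> borel_measurable M"
    and bd: "\<And>i x. i \<in> I \<Longrightarrow> x \<in> space M \<Longrightarrow> 0 \<le> \<phi> i x \<and> \<phi> i x \<le> 1"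
    and w: "\<And>i. i \<in> I \<Longrightarrow> 0 < w i" "(\<Sum>i\<in>I. w i) \<le> 1 / 2"
    and l: "0 < l" "l \<le> 1" and m: "1 \<le> m"
  shows "\<exists>\<xi>. (\<forall>j\<in>{1..m}. \<xi> j \<in> space M) \<and>
    (\<forall>i\<in>I. \<bar>1 / real m * (\<Sum>j=1..m. \<phi> i (\<xi> j)) - expectation (\<phi> i)\<bar>
        \<le> l * expectation (\<phi> i) + ln (1 / w i) / (real m * l))"
proof -
  define p where "p i = expectation (\<phi> i)" for i
  \<comment> \<open>The sign \<open>s\<close> selects the upper or the lower tail; it disappears
    from the compensator because it is squared.\<close>
  define G where "G = (\<lambda>(i, s) x. exp (s * l * (\<phi> i x - p i) - (s * l)\<^sup>2 * p i))"
  let ?I = "I \<times> {1, -1 :: real}"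
  have "\<exists>\<xi>. (\<forall>j\<in>{1..m}. \<xi> j \<in> space M) \<and>
    (\<Sum>z\<in>?I. w (fst z) * (\<Prod>j=1..m. G z (\<xi> j))) \<le> (\<Sum>z\<in>?I. w (fst z))"
  proof (rule exists_sample)
    fix z assume "z \<in> ?I"
    then obtain i s where z: "z = (i, s)" "i \<in> I" "\<bar>s * l\<bar> \<le> 1" using l by auto
    show "integrable M (G z)" "expectation (G z) \<le> 1"
      using exponential_moment_le[OF meas[OF z(2)] bd[OF z(2)] z(3)] by (auto simp: G_def z(1) p_def)
    show "0 \<le> w (fst z)" using w(1)[OF z(2)] z(1) by simp
  qed (auto simp: G_def)
  then obtain \<xi> where \<xi>: "\<forall>j\<in>{1..m}. \<xi> j \<in> space M"
    "(\<Sum>z\<in>?I. w (fst z) * (\<Prod>j=1..m. G z (\<xi> j))) \<le> (\<Sum>z\<in>?I. w (fst z))" by blast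
  have "(\<Sum>z\<in>?I. w (fst z)) = (\<Sum>i\<in>I. \<Sum>s\<in>{1, -1::real}. w i)"
    by (subst sum.cartesian_product) (simp add: case_prod_beta)
  also have "\<dots> \<le> 1" using w(2) by (simp add: sum_distrib_left[symmetric])
  \<comment> \<open>All summands are nonnegative, so each single product is at most
    \<open>1 / w\<close>; its logarithm is the deviation bound for one index and one tail.\<close>
  finally have W: "(\<Sum>z\<in>?I. w (fst z) * (\<Prod>j=1..m. G z (\<xi> j))) \<le> 1" using \<xi>(2) by linarith
  have key: "s * (1 / real m * (\<Sum>j=1..m. \<phi> i (\<xi> j)) - p i) \<le> l * p i + ln (1 / w i) / (real m * l)"
    if i: "i \<in> I" and s: "s \<in> {1, -1}" for i s
  proof -
    have "w i * (\<Prod>j=1..m. G (i, s) (\<xi> j)) \<le> 1"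
    proof (rule order_trans[OF _ W])
      have "(\<lambda>z. w (fst z) * (\<Prod>j=1..m. G z (\<xi> j))) (i, s)
          \<le> (\<Sum>z\<in>?I. w (fst z) * (\<Prod>j=1..m. G z (\<xi> j)))"
        using i s fin w(1)
        by (intro member_le_sum mult_nonneg_nonneg prod_nonneg) (auto simp: G_def less_imp_le)
      then show "w i * (\<Prod>j=1..m. G (i, s) (\<xi> j)) \<le> (\<Sum>z\<in>?I. w (fst z) * (\<Prod>j=1..m. G z (\<xi> j)))"
        by simp
    qed
    moreover have "(\<Prod>j=1..m. G (i, s) (\<xi> j)) = exp (\<Sum>j=1..m. s * l * (\<phi> i (\<xi> j) - p i) - l\<^sup>2 * p i)"
      using s by (auto simp: G_def exp_sum)
    ultimately have "exp (\<Sum>j=1..m. s * l * (\<phi> i (\<xi> j) - p i) - l\<^sup>2 * p i) \<le> 1 / w i"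
      using w(1)[OF i] by (simp add: field_simps)
    then have "(\<Sum>j=1..m. s * l * (\<phi> i (\<xi> j) - p i) - l\<^sup>2 * p i) \<le> ln (1 / w i)"
      using w(1)[OF i] by (subst ln_ge_iff) auto
    moreover have "(\<Sum>j=1..m. s * l * (\<phi> i (\<xi> j) - p i) - l\<^sup>2 * p i)
        = real m * l * (s * (1 / real m * (\<Sum>j=1..m. \<phi> i (\<xi> j)) - p i) - l * p i)"
      using m by (simp add: sum_subtractf sum_distrib_left[symmetric] field_simps power2_eq_square)
    ultimately have "s * (1 / real m * (\<Sum>j=1..m. \<phi> i (\<xi> j)) - p i) - l * p i \<le> ln (1 / w i) / (real m * l)"
      using m l by (simp add: pos_le_divide_eq mult.commute)
    then show ?thesis by linarith
  qed
  have "\<bar>1 / real m * (\<Sum>j=1..m. \<phi> i (\<xi> j)) - p i\<bar> \<le> l * p i + ln (1 / w i) / (real m * l)"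
    if "i \<in> I" for i
    using key[OF that, of 1] key[OF that, of "-1"] by (auto simp: abs_le_iff)
  then show ?thesis using \<xi>(1) unfolding p_def by blast
qed

section \<open>Dyadic layers of a power\<close>

lemma powr_diff_le:
  fixes q :: real
  assumes "1 \<le> q" "0 \<le> z" "z \<le> y"
  shows "y powr q - z powr q \<le> q * y powr (q - 1) * (y - z)"
proof (cases "z = y")
  case True
  then show ?thesis by simp
next
  case False
  with assms have "z < y" by simp
  have "\<exists>l u. z < u \<and> u < y \<and> DERIV (\<lambda>x. x powr q) u :> l \<and> y powr q - z powr q = (y - z) * l"
  proof (rule MVT[OF \<open>z < y\<close>])
    show "continuous_on {z..y} (\<lambda>x. x powr q)"
      using assms by (intro continuous_on_powr' continuous_intros) auto
    show "(\<lambda>x. x powr q) differentiable (at x)" if "z < x" "x < y" for x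
      unfolding real_differentiable_def
      using that assms by (intro exI[of _ "q * x powr (q - 1)"]) (auto intro!: derivative_eq_intros)
  qed
  then obtain l u where u: "z < u" "u < y" "DERIV (\<lambda>x. x powr q) u :> l"
    "y powr q - z powr q = (y - z) * l" by blast
  have "DERIV (\<lambda>x. x powr q) u :> q * u powr (q - 1)"
    using u assms by (auto intro!: derivative_eq_intros)
  then have l: "l = q * u powr (q - 1)" using u(3) DERIV_unique by blast
  have "u powr (q - 1) \<le> y powr (q - 1)"
    using u assms by (intro powr_mono2) auto
  then have "l \<le> q * y powr (q - 1)" using l assms by (simp add: mult_left_mono)
  then have "(y - z) * l \<le> (y - z) * (q * y powr (q - 1))"
    using \<open>z < y\<close> by (intro mult_left_mono) auto
  then show ?thesis using u(4) by (simp add: mult_ac)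
qed

text \<open>The levels start at \<open>1 / 16\<close>: since \<open>q \<ge> 1\<close>, the part of
  \<open>y powr q\<close> below this level is at most \<open>1 / 16\<close> and can be
  discarded.\<close>

definition dyadic_level :: "nat \<Rightarrow> real"
  where "dyadic_level j = 2 ^ j / 16"

text \<open>Increments of truncated powers telescope over \<open>j\<close>, which cuts
  \<open>y powr q\<close> into layers that are continuous in \<open>y\<close>, unlike indicator
  functions of level sets.\<close>

definition power_layer :: "real \<Rightarrow> nat \<Rightarrow> real \<Rightarrow> real"
  where "power_layer q j y = min y (dyadic_level j) powr q - min y (dyadic_level (j - 1)) powr q"

lemma dyadic_level_pos [simp]: "0 < dyadic_level j"
  by (simp add: dyadic_level_def)

lemma dyadic_level_nonneg [simp]: "0 \<le> dyadic_level j"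
  by (simp add: dyadic_level_def)

lemma dyadic_level_neq_0 [simp]: "dyadic_level j \<noteq> 0"
  by (simp add: dyadic_level_def)

lemma dyadic_level_Suc: "dyadic_level (Suc j) = 2 * dyadic_level j"
  by (simp add: dyadic_level_def)

lemma dyadic_level_mono: "i \<le> j \<Longrightarrow> dyadic_level i \<le> dyadic_level j"
  by (simp add: dyadic_level_def divide_right_mono)

text \<open>The ratio \<open>2 powr q\<close> of the geometric series is at least 2, so the constant
  2 does not depend on \<open>q\<close>.\<close>

lemma sum_dyadic_level_le:
  assumes "1 \<le> q"
  shows "(\<Sum>j=1..J. dyadic_level j powr q) \<le> 2 * dyadic_level J powr q"
proof (induction J)
  case 0
  then show ?case by simp
next
  case (Suc J)
  have "2 * dyadic_level J powr q \<le> 2 powr q * dyadic_level J powr q"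
    using powr_mono[of 1 q 2] assms by (intro mult_right_mono) auto
  also have "\<dots> = dyadic_level (Suc J) powr q"
    by (simp add: dyadic_level_Suc powr_mult)
  finally show ?case using Suc by simp
qed

text \<open>This keeps the number of layers out of two estimates: the total approximation error,
  where \<open>T\<close> is a multiple of \<open>y\<close>, and the cost of the crude nets, where
  \<open>T\<close> is the threshold between the two kinds of nets.\<close>

lemma sum_dyadic_level_upto_le:
  assumes "1 \<le> q" "0 \<le> T"
  shows "(\<Sum>j=1..J. if dyadic_level j \<le> T then dyadic_level j powr q else 0) \<le> 2 * T powr q"
proof (induction J)
  case 0
  then show ?case by simp
next
  case (Suc J)
  show ?case
  proof (cases "dyadic_level (Suc J) \<le> T")
    case True
    have "(\<Sum>j=1..Suc J. if dyadic_level j \<le> T then dyadic_level j powr q else 0)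
        \<le> (\<Sum>j=1..Suc J. dyadic_level j powr q)"
      by (intro sum_mono) auto
    also have "\<dots> \<le> 2 * dyadic_level (Suc J) powr q"
      by (rule sum_dyadic_level_le[OF assms(1)])
    also have "\<dots> \<le> 2 * T powr q"
      using True assms by (auto intro!: powr_mono2)
    finally show ?thesis .
  next
    case False
    then show ?thesis using Suc by simp
  qed
qed

lemma power_layer_bounds:
  assumes "1 \<le> q" "0 \<le> y"
  shows "0 \<le> power_layer q j y" "power_layer q j y \<le> y powr q"
    "power_layer q j y \<le> dyadic_level j powr q"
proof -
  have "min y (dyadic_level (j - 1)) \<le> min y (dyadic_level j)"
    using dyadic_level_mono[of "j - 1" j] by auto
  then show "0 \<le> power_layer q j y"
    using assms unfolding power_layer_def
    by (auto intro!: powr_mono2)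
  have "min y (dyadic_level j) powr q \<le> y powr q"
    "min y (dyadic_level j) powr q \<le> dyadic_level j powr q"
    using assms by (auto intro!: powr_mono2)
  then show "power_layer q j y \<le> y powr q" "power_layer q j y \<le> dyadic_level j powr q"
    unfolding power_layer_def by (smt (verit) powr_ge_zero)+
qed

lemma borel_measurable_power_layer [measurable]:
  assumes [measurable]: "f \<in> borel_measurable M"
  shows "(\<lambda>x. power_layer q j (f x)) \<in> borel_measurable M"
  unfolding power_layer_def by measurable

lemma sum_power_layer:
  assumes "0 \<le> y" "y \<le> dyadic_level J"
  shows "(\<Sum>j=1..J. power_layer q j y) = y powr q - min y (1 / 16) powr q"
proof -
  have "(\<Sum>j=1..J. power_layer q j y) = min y (dyadic_level J) powr q - min y (dyadic_level 0) powr q"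
    unfolding power_layer_def by (induction J) auto
  then show ?thesis using assms by (simp add: dyadic_level_def min_absorb1)
qed

text \<open>In this form \<open>y\<close> enters through a single power of a value clamped to the
  layer, so one application of \<open>powr_diff_le\<close> gives the Lipschitz constant.\<close>

lemma power_layer_eq_clamp:
  "power_layer q j y =
    max (dyadic_level (j - 1)) (min y (dyadic_level j)) powr q - dyadic_level (j - 1) powr q"
  using dyadic_level_mono[of "j - 1" j] by (auto simp: power_layer_def min_def max_def)

lemma power_layer_Lipschitz:
  assumes "1 \<le> q" "0 \<le> y" "0 \<le> z"
  shows "\<bar>power_layer q j y - power_layer q j z\<bar> \<le> q * dyadic_level j powr (q - 1) * \<bar>y - z\<bar>"
proof -
  define c where "c = (\<lambda>y. max (dyadic_level (j - 1)) (min y (dyadic_level j)))"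
  have c: "0 \<le> c y" "c y \<le> dyadic_level j" "\<bar>c y - c z\<bar> \<le> \<bar>y - z\<bar>" for y z
    using dyadic_level_mono[of "j - 1" j] by (auto simp: c_def le_max_iff_disj)
  have *: "c y powr q - c z powr q \<le> q * dyadic_level j powr (q - 1) * \<bar>y - z\<bar>" if "c z \<le> c y" for y z
  proof -
    have "c y powr q - c z powr q \<le> q * c y powr (q - 1) * (c y - c z)"
      using that assms c by (intro powr_diff_le) auto
    also have "\<dots> \<le> q * dyadic_level j powr (q - 1) * \<bar>y - z\<bar>"
      using that assms c(1)[of y] c(2)[of y] c(3)[of y z]
      by (intro mult_mono mult_left_mono powr_mono2) auto
    finally show ?thesis .
  qed
  have mono: "c z powr q \<le> c y powr q" if "c z \<le> c y" for y z
    using that c assms by (intro powr_mono2) auto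
  have "\<bar>c y powr q - c z powr q\<bar> \<le> q * dyadic_level j powr (q - 1) * \<bar>y - z\<bar>"
    using *[of z y] *[of y z] mono[of z y] mono[of y z] by (cases "c z \<le> c y") (auto simp: abs_minus_commute)
  then show ?thesis by (simp add: power_layer_eq_clamp c_def)
qed

text \<open>If \<open>4 * y\<close> is below the level, then \<open>a \<le> 1 / 4\<close> puts
  \<open>z\<close> below half the level as well. Half the level is the previous one, so both layers
  vanish.\<close>

lemma power_layer_diff_le:
  assumes q: "1 \<le> q" and yz: "0 \<le> y" "0 \<le> z" and a: "0 \<le> a" "a \<le> 1 / 4" and j: "1 \<le> j"
    and d: "\<bar>y - z\<bar> \<le> a * dyadic_level j"
  shows "\<bar>power_layer q j y - power_layer q j z\<bar>
    \<le> q * a * (if dyadic_level j \<le> 4 * y then dyadic_level j powr q else 0)"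
proof (cases "dyadic_level j \<le> 4 * y")
  case True
  have "\<bar>power_layer q j y - power_layer q j z\<bar> \<le> q * dyadic_level j powr (q - 1) * (a * dyadic_level j)"
    using power_layer_Lipschitz[OF q yz, of j] q d
    by (smt (verit, best) mult_left_mono mult_nonneg_nonneg powr_ge_zero)
  also have "\<dots> = q * a * dyadic_level j powr q"
    by (simp add: powr_diff abs_of_pos)
  finally show ?thesis using True by simp
next
  case False
  have s: "dyadic_level j = 2 * dyadic_level (j - 1)"
    using dyadic_level_Suc[of "j - 1"] j by simp
  have "a * dyadic_level j \<le> 1 / 4 * dyadic_level j"
    using a by (intro mult_right_mono) auto
  then have "y \<le> dyadic_level (j - 1)" "z \<le> dyadic_level (j - 1)"
    using False d s by linarith+
  then have "min y (dyadic_level j) = min y (dyadic_level (j - 1))"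
    "min z (dyadic_level j) = min z (dyadic_level (j - 1))"
    using s dyadic_level_pos[of "j - 1"] by linarith+
  then show ?thesis using False by (simp add: power_layer_def)
qed

text \<open>The layers take their nonzero values where \<open>y\<close> is comparable to or exceeds the level, so the
  errors of all layers sum to a geometric series dominated by \<open>y powr q\<close>.\<close>

lemma layer_approximation:
  assumes q: "1 \<le> q" and y: "0 \<le> y" "y \<le> dyadic_level J"
    and z: "\<And>j. j \<in> {1..J} \<Longrightarrow> 0 \<le> z j"
    and d: "\<And>j. j \<in> {1..J} \<Longrightarrow> \<bar>y - z j\<bar> \<le> 1 / (32 * q * 4 powr q) * dyadic_level j"
  shows "\<bar>y powr q - (\<Sum>j=1..J. power_layer q j (z j))\<bar> \<le> y powr q / 16 + 1 / 16"
proof -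
  \<comment> \<open>Chosen so that \<open>q * a * 2 * 4 powr q = 1 / 16\<close>, the product of the
    Lipschitz factor, the mesh and the geometric series up to \<open>4 * y\<close>.\<close>
  define a where "a = 1 / (32 * q * 4 powr q)"
  have "32 * 1 * 1 \<le> 32 * q * 4 powr q"
    using q by (intro mult_mono ge_one_powr_ge_zero) auto
  then have a: "0 \<le> a" "a \<le> 1 / 4" using q by (auto simp: a_def field_simps)
  have "\<bar>(\<Sum>j=1..J. power_layer q j y) - (\<Sum>j=1..J. power_layer q j (z j))\<bar>
      \<le> (\<Sum>j=1..J. \<bar>power_layer q j y - power_layer q j (z j)\<bar>)"
    unfolding sum_subtractf[symmetric] by (rule sum_abs)
  also have "\<dots> \<le> (\<Sum>j=1..J. q * a * (if dyadic_level j \<le> 4 * y then dyadic_level j powr q else 0))"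
    using q y a z d by (intro sum_mono power_layer_diff_le) (auto simp: a_def)
  also have "\<dots> = q * a * (\<Sum>j=1..J. if dyadic_level j \<le> 4 * y then dyadic_level j powr q else 0)"
    by (simp add: sum_distrib_left)
  also have "\<dots> \<le> q * a * (2 * (4 * y) powr q)"
    using q y a by (intro mult_left_mono sum_dyadic_level_upto_le) auto
  also have "\<dots> = y powr q / 16"
    using q y by (simp add: a_def powr_mult)
  finally have 1: "\<bar>(\<Sum>j=1..J. power_layer q j y) - (\<Sum>j=1..J. power_layer q j (z j))\<bar> \<le> y powr q / 16" .
  have "min y (1 / 16) powr q \<le> (1 / 16) powr q"
    using q y by (intro powr_mono2) auto
  also have "\<dots> \<le> (1 / 16) powr 1"
    using q by (intro powr_mono') auto
  finally have "min y (1 / 16) powr q \<le> 1 / 16" by simp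
  then show ?thesis using 1 sum_power_layer[OF y, of q] powr_ge_zero[of "min y (1/16)" q] by linarith
qed

section \<open>Discretization from a sequence of nets\<close>

text \<open>Three errors add up: replacing layers inside the sample mean costs
  \<open>S / 16 + 1 / 16\<close>, inside the integral \<open>E / 16 + 1 / 16\<close>, and sampling
  the net elements costs the budget \<open>1 / 16\<close>. The first two come from one pointwise
  estimate, so the sample has to be controlled on the nets only.\<close>

lemma (in prob_space) discretization_from_nets:
  fixes A :: "('a \<Rightarrow> real) set" and net :: "nat \<Rightarrow> ('a \<Rightarrow> real) set" and m :: nat
  assumes q: "1 \<le> q" and J: "1 \<le> J" and m: "1 \<le> m" and l: "0 < l" "l \<le> 1"
    and meas: "\<And>f. f \<in> A \<Longrightarrow> f \<in> borel_measurable M"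
    and bd: "\<And>f x. f \<in> A \<Longrightarrow> x \<in> space M \<Longrightarrow> 0 \<le> f x \<and> f x \<le> dyadic_level J"
    and ball: "\<And>f. f \<in> A \<Longrightarrow> expectation (\<lambda>x. f x powr q) \<le> 1"
    and net: "\<And>j. j \<in> {1..J} \<Longrightarrow> finite (net j) \<and> net j \<noteq> {} \<and> net j \<subseteq> A"
    and cover: "\<And>j f. j \<in> {1..J} \<Longrightarrow> f \<in> A \<Longrightarrow>
      \<exists>g\<in>net j. \<forall>x\<in>space M. \<bar>f x - g x\<bar> \<le> 1 / (32 * q * 4 powr q) * dyadic_level j"
    and budget: "(\<Sum>j=1..J. l + dyadic_level j powr q * ln (2 * real J * real (card (net j))) / (real m * l))
      \<le> 1 / 16"
  shows "\<exists>\<xi>. (\<forall>i\<in>{1..m}. \<xi> i \<in> space M) \<and>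
    (\<forall>f\<in>A. let S = 1 / real m * (\<Sum>i=1..m. f (\<xi> i) powr q); E = expectation (\<lambda>x. f x powr q)
      in \<bar>S - E\<bar> \<le> (S + E) / 16 + 3 / 16)"
proof -
  define I where "I = (SIGMA j:{1..J}. net j)"
  define \<phi> where "\<phi> = (\<lambda>(j, g) (x :: 'a). power_layer q j (g x) / dyadic_level j powr q)"
  \<comment> \<open>Every layer receives the share \<open>1 / (2 * J)\<close> of the total weight,
    divided evenly over its net.\<close>
  define w where "w = (\<lambda>(j, g :: 'a \<Rightarrow> real). 1 / (2 * real J * real (card (net j))))"
  have card_pos: "0 < card (net j)" if "j \<in> {1..J}" for j
    using net[OF that] by (simp add: card_gt_0_iff)
  have IA: "j \<in> {1..J}" "g \<in> A" if "(j, g) \<in> I" for j g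
    using that net by (auto simp: I_def)
  have "\<exists>\<xi>. (\<forall>i\<in>{1..m}. \<xi> i \<in> space M) \<and>
    (\<forall>z\<in>I. \<bar>1 / real m * (\<Sum>i=1..m. \<phi> z (\<xi> i)) - expectation (\<phi> z)\<bar>
        \<le> l * expectation (\<phi> z) + ln (1 / w z) / (real m * l))"
  proof (rule exists_sample_small_deviation[OF _ _ _ _ _ l m])
    show "finite I" using net by (auto simp: I_def)
    show "\<phi> z \<in> borel_measurable M" if "z \<in> I" for z
    proof -
      obtain j g where z: "z = (j, g)" by (cases z)
      then have [measurable]: "g \<in> borel_measurable M" using IA that meas by auto
      show ?thesis unfolding \<phi>_def z by simp
    qed
    show "0 \<le> \<phi> z x \<and> \<phi> z x \<le> 1" if "z \<in> I" "x \<in> space M" for z x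
    proof -
      obtain j g where z: "z = (j, g)" by (cases z)
      then have "0 \<le> g x" using IA that bd by auto
      then show ?thesis using power_layer_bounds[OF q] by (simp add: \<phi>_def z divide_le_eq)
    qed
    show "0 < w z" if "z \<in> I" for z
      using that card_pos J by (auto simp: I_def w_def)
    have "(\<Sum>z\<in>I. w z) = (\<Sum>j\<in>{1..J}. \<Sum>g\<in>net j. 1 / (2 * real J * real (card (net j))))"
      unfolding I_def w_def using net by (subst sum.Sigma) auto
    also have "\<dots> = (\<Sum>j\<in>{1..J}. 1 / (2 * real J))"
      using card_pos by (intro sum.cong) (auto simp: field_simps)
    also have "\<dots> = 1 / 2" using J by simp
    finally show "(\<Sum>z\<in>I. w z) \<le> 1 / 2" by simp
  qed
  then obtain \<xi> where \<xi>: "\<And>i. i \<in> {1..m} \<Longrightarrow> \<xi> i \<in> space M"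
    and dev: "\<And>z. z \<in> I \<Longrightarrow> \<bar>1 / real m * (\<Sum>i=1..m. \<phi> z (\<xi> i)) - expectation (\<phi> z)\<bar>
        \<le> l * expectation (\<phi> z) + ln (1 / w z) / (real m * l)" by blast
  have int_powr: "integrable M (\<lambda>x. f x powr q)" if "f \<in> A" for f
  proof (rule integrable_abs_le_const[where b = "dyadic_level J powr q"])
    show "(\<lambda>x. f x powr q) \<in> borel_measurable M" using meas[OF that] by measurable
    show "\<bar>f x powr q\<bar> \<le> dyadic_level J powr q" if "x \<in> space M" for x
      using bd[OF \<open>f \<in> A\<close> that] q by (auto intro!: powr_mono2)
  qed
  have int_layer: "integrable M (\<lambda>x. power_layer q j (g x))" if "g \<in> A" for g j
  proof (rule integrable_abs_le_const[where b = "dyadic_level j powr q"])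
    show "(\<lambda>x. power_layer q j (g x)) \<in> borel_measurable M" using meas[OF that] by measurable
    show "\<bar>power_layer q j (g x)\<bar> \<le> dyadic_level j powr q" if "x \<in> space M" for x
      using bd[OF \<open>g \<in> A\<close> that] power_layer_bounds[OF q] by auto
  qed
  have layer_dev: "\<bar>1 / real m * (\<Sum>i=1..m. power_layer q j (g (\<xi> i)))
      - expectation (\<lambda>x. power_layer q j (g x))\<bar>
      \<le> l + dyadic_level j powr q * ln (2 * real J * real (card (net j))) / (real m * l)"
    if jg: "(j, g) \<in> I" for j g
  proof -
    let ?t = "dyadic_level j powr q"
    have gA: "g \<in> A" using IA jg by auto
    have E: "expectation (\<phi> (j, g)) = expectation (\<lambda>x. power_layer q j (g x)) / ?t"
      by (simp add: \<phi>_def)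
    have "expectation (\<lambda>x. power_layer q j (g x)) \<le> expectation (\<lambda>x. g x powr q)"
      using bd[OF gA] power_layer_bounds(2)[OF q]
      by (intro integral_mono int_layer int_powr gA) auto
    \<comment> \<open>The normalized layer has mean at most \<open>1 / ?t\<close>, so the term
      \<open>l * p\<close> of the deviation is only \<open>l\<close> after multiplying back by
      \<open>?t\<close>.\<close>
    with ball[OF gA] have E1: "?t * expectation (\<phi> (j, g)) \<le> 1" unfolding E by simp
    have "\<bar>1 / real m * (\<Sum>i=1..m. power_layer q j (g (\<xi> i))) - expectation (\<lambda>x. power_layer q j (g x))\<bar>
      = \<bar>?t * (1 / real m * (\<Sum>i=1..m. \<phi> (j, g) (\<xi> i)) - expectation (\<phi> (j, g)))\<bar>"
      unfolding E by (simp add: \<phi>_def right_diff_distrib sum_divide_distrib[symmetric])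
    also have "\<dots> \<le> ?t * (l * expectation (\<phi> (j, g)) + ln (1 / w (j, g)) / (real m * l))"
      using dev[OF jg] by (simp add: abs_mult mult_left_mono)
    also have "\<dots> = l * (?t * expectation (\<phi> (j, g))) + ?t * ln (1 / w (j, g)) / (real m * l)"
      by (simp add: algebra_simps)
    also have "\<dots> \<le> l * 1 + ?t * ln (1 / w (j, g)) / (real m * l)"
      using E1 l by (intro add_mono mult_left_mono) auto
    finally show ?thesis by (simp add: w_def)
  qed
  have "\<bar>S - E\<bar> \<le> (S + E) / 16 + 3 / 16"
    if f: "f \<in> A" and S: "S = 1 / real m * (\<Sum>i=1..m. f (\<xi> i) powr q)"
      and E: "E = expectation (\<lambda>x. f x powr q)" for f S E
  proof -
    have "\<forall>j\<in>{1..J}. \<exists>g. g \<in> net j \<and> (\<forall>x\<in>space M. \<bar>f x - g x\<bar> \<le> 1 / (32 * q * 4 powr q) * dyadic_level j)"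
      using cover[OF _ f] by blast
    then obtain g where g: "\<And>j. j \<in> {1..J} \<Longrightarrow> g j \<in> net j"
      "\<And>j x. j \<in> {1..J} \<Longrightarrow> x \<in> space M \<Longrightarrow> \<bar>f x - g j x\<bar> \<le> 1 / (32 * q * 4 powr q) * dyadic_level j"
      by metis
    have gA: "g j \<in> A" if "j \<in> {1..J}" for j using g(1)[OF that] net[OF that] by auto
    \<comment> \<open>The approximant mixes different net elements across the layers.\<close>
    define Z where "Z x = (\<Sum>j=1..J. power_layer q j (g j x))" for x
    have Z: "\<bar>f x powr q - Z x\<bar> \<le> f x powr q / 16 + 1 / 16" if "x \<in> space M" for x
      unfolding Z_def using bd[OF f that] bd[OF gA that] g(2)[OF _ that]
      by (intro layer_approximation q) auto
    have intZ: "integrable M Z" unfolding Z_def by (intro Bochner_Integration.integrable_sum int_layer gA)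
    have EZ: "expectation Z = (\<Sum>j=1..J. expectation (\<lambda>x. power_layer q j (g j x)))"
      unfolding Z_def using int_layer[OF gA] by (subst Bochner_Integration.integral_sum) auto
    define SZ where "SZ = 1 / real m * (\<Sum>i=1..m. Z (\<xi> i))"
    have SZ: "SZ = (\<Sum>j=1..J. 1 / real m * (\<Sum>i=1..m. power_layer q j (g j (\<xi> i))))"
      unfolding SZ_def Z_def by (subst sum.swap) (simp add: sum_distrib_left)
    have "\<bar>SZ - expectation Z\<bar> \<le> (\<Sum>j=1..J. \<bar>1 / real m * (\<Sum>i=1..m. power_layer q j (g j (\<xi> i)))
        - expectation (\<lambda>x. power_layer q j (g j x))\<bar>)"
      unfolding SZ EZ sum_subtractf[symmetric] by (rule sum_abs)
    also have "\<dots> \<le> (\<Sum>j=1..J. l + dyadic_level j powr q * ln (2 * real J * real (card (net j))) / (real m * l))"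
      using g(1) by (intro sum_mono layer_dev) (auto simp: I_def)
    also note budget
    finally have 1: "\<bar>SZ - expectation Z\<bar> \<le> 1 / 16" .
    have "E - expectation Z = expectation (\<lambda>x. f x powr q - Z x)"
      unfolding E by (subst Bochner_Integration.integral_diff) (auto intro: int_powr f intZ)
    also have "\<bar>\<dots>\<bar> \<le> expectation (\<lambda>x. \<bar>f x powr q - Z x\<bar>)"
      by (rule integral_abs_bound)
    also have "\<dots> \<le> expectation (\<lambda>x. f x powr q / 16 + 1 / 16)"
      using Z int_powr[OF f] intZ by (intro integral_mono) auto
    also have "\<dots> = E / 16 + 1 / 16"
      unfolding E using int_powr[OF f] by (simp add: prob_space)
    finally have 2: "\<bar>E - expectation Z\<bar> \<le> E / 16 + 1 / 16" .
    have "S - SZ = 1 / real m * (\<Sum>i=1..m. f (\<xi> i) powr q - Z (\<xi> i))"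
      unfolding S SZ_def by (simp add: sum_subtractf right_diff_distrib)
    also have "\<bar>\<dots>\<bar> \<le> 1 / real m * (\<Sum>i=1..m. \<bar>f (\<xi> i) powr q - Z (\<xi> i)\<bar>)"
      by (simp add: abs_mult divide_right_mono sum_abs)
    also have "\<dots> \<le> 1 / real m * (\<Sum>i=1..m. f (\<xi> i) powr q / 16 + 1 / 16)"
      using Z \<xi> by (intro mult_left_mono sum_mono) auto
    also have "\<dots> = S / 16 + 1 / 16"
      unfolding S using m by (simp add: sum.distrib sum_divide_distrib[symmetric] field_simps)
    finally have 3: "\<bar>S - SZ\<bar> \<le> S / 16 + 1 / 16" .
    show ?thesis using 1 2 3 unfolding abs_le_iff add_divide_distrib by auto
  qed
  then show ?thesis using \<xi> by (intro exI[of _ \<xi>]) (auto simp: Let_def)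
qed

section \<open>Orthonormal bases and coarse nets\<close>

text \<open>The coefficients are real even for complex-valued functions; this lets one construction
  of nets serve both scalar fields.\<close>

definition lincomb :: "nat \<Rightarrow> (nat \<Rightarrow> real) \<Rightarrow> (nat \<Rightarrow> 'a \<Rightarrow> 'b::real_vector) \<Rightarrow> 'a \<Rightarrow> 'b"
  where "lincomb n c b = (\<lambda>x. \<Sum>i<n. c i *\<^sub>R b i x)"

text \<open>\<open>norm_le\<close> is a Nikolskii inequality: \<open>K\<close> bounds the uniform
  norm on the \<open>L_q\<close> unit ball. Being pointwise, it also separates points of
  \<open>X\<close> despite null sets of the measure. Real and complex values are both covered
  through the real inner product of a Euclidean codomain.\<close>

locale real_function_space = prob_space M
  for M :: "'a measure" +
  fixes X :: "('a \<Rightarrow> 'b::euclidean_space) set" and q K :: real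
  assumes zero_mem: "(\<lambda>x. 0) \<in> X"
    and add_mem: "f \<in> X \<Longrightarrow> g \<in> X \<Longrightarrow> (\<lambda>x. f x + g x) \<in> X"
    and scale_mem: "f \<in> X \<Longrightarrow> (\<lambda>x. c *\<^sub>R f x) \<in> X"
    and meas: "f \<in> X \<Longrightarrow> f \<in> borel_measurable M"
    and zero_outside: "f \<in> X \<Longrightarrow> x \<notin> space M \<Longrightarrow> f x = 0"
    and q_ge_1: "1 \<le> q" and K_ge_1: "1 \<le> K"
    and norm_le: "f \<in> X \<Longrightarrow> x \<in> space M \<Longrightarrow> norm (f x) \<le> K * expectation (\<lambda>x. norm (f x) powr q) powr (1 / q)"
begin

lemma bounded:
  assumes "f \<in> X"
  obtains c where "0 \<le> c" "\<And>x. x \<in> space M \<Longrightarrow> norm (f x) \<le> c"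
proof (rule that)
  show "0 \<le> K * expectation (\<lambda>x. norm (f x) powr q) powr (1 / q)"
    using K_ge_1 by simp
qed (rule norm_le[OF assms])

lemma integrable_powr:
  assumes "f \<in> X" "0 \<le> p"
  shows "integrable M (\<lambda>x. norm (f x) powr p)"
proof -
  obtain c where c: "0 \<le> c" "\<And>x. x \<in> space M \<Longrightarrow> norm (f x) \<le> c"
    using bounded[OF assms(1)] by blast
  note [measurable] = meas[OF assms(1)]
  show ?thesis
  proof (rule integrable_const_bound[where B = "c powr p"])
    show "AE x in M. norm (norm (f x) powr p) \<le> c powr p"
      using c assms(2) by (intro AE_I2) (auto intro!: powr_mono2)
  qed measurable
qed

lemma integrable_inner:
  assumes "f \<in> X" "g \<in> X"
  shows "integrable M (\<lambda>x. f x \<bullet> g x)"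
proof -
  obtain c where c: "0 \<le> c" "\<And>x. x \<in> space M \<Longrightarrow> norm (f x) \<le> c"
    using bounded[OF assms(1)] by blast
  obtain d where d: "0 \<le> d" "\<And>x. x \<in> space M \<Longrightarrow> norm (g x) \<le> d"
    using bounded[OF assms(2)] by blast
  note [measurable] = meas[OF assms(1)] meas[OF assms(2)]
  show ?thesis
  proof (rule integrable_const_bound[where B = "c * d"])
    show "AE x in M. norm (f x \<bullet> g x) \<le> c * d"
    proof (intro AE_I2)
      fix x assume x: "x \<in> space M"
      have "norm (f x \<bullet> g x) \<le> norm (f x) * norm (g x)"
        by (simp add: Cauchy_Schwarz_ineq2)
      also have "\<dots> \<le> c * d" using c d x by (intro mult_mono) auto
      finally show "norm (f x \<bullet> g x) \<le> c * d" .
    qed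
  qed measurable
qed

lemma eq_zero:
  assumes f: "f \<in> X" and 0: "expectation (\<lambda>x. norm (f x) powr q) = 0"
  shows "f = (\<lambda>x. 0)"
proof
  fix x show "f x = 0"
    using norm_le[OF f, of x] zero_outside[OF f, of x] 0 by (cases "x \<in> space M") auto
qed

text \<open>Vanishing almost everywhere makes the \<open>L_q\<close> norm zero, and
  \<open>norm_le\<close> turns this into vanishing everywhere.\<close>

lemma definite:
  assumes f: "f \<in> X" and 0: "expectation (\<lambda>x. f x \<bullet> f x) = 0"
  shows "f = (\<lambda>x. 0)"
proof -
  have "AE x in M. f x \<bullet> f x = 0"
    using integral_nonneg_eq_0_iff_AE[OF integrable_inner[OF f f]] 0 by simp
  then have "AE x in M. norm (f x) powr q = 0" by simp
  then have "expectation (\<lambda>x. norm (f x) powr q) = 0"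
    by (rule integral_eq_zero_AE)
  then show ?thesis by (rule eq_zero[OF f])
qed

lemma lincomb_mem: "(\<And>i. i < n \<Longrightarrow> b i \<in> X) \<Longrightarrow> lincomb n c b \<in> X"
proof (induction n)
  case 0
  then show ?case by (simp add: lincomb_def zero_mem)
next
  case (Suc n)
  then have "(\<lambda>x. lincomb n c b x + c n *\<^sub>R b n x) \<in> X"
    by (intro add_mem scale_mem) auto
  then show ?case by (simp add: lincomb_def)
qed

definition orthonormal :: "nat \<Rightarrow> (nat \<Rightarrow> 'a \<Rightarrow> 'b) \<Rightarrow> bool"
  where "orthonormal r u \<longleftrightarrow> (\<forall>i<r. u i \<in> X) \<and>
    (\<forall>i<r. \<forall>k<r. expectation (\<lambda>x. u i x \<bullet> u k x) = (if i = k then 1 else 0))"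

lemma expectation_lincomb:
  assumes u: "orthonormal r u" and k: "k < r"
  shows "expectation (\<lambda>x. lincomb r d u x \<bullet> u k x) = d k"
proof -
  have "expectation (\<lambda>x. lincomb r d u x \<bullet> u k x) = expectation (\<lambda>x. \<Sum>i<r. d i * (u i x \<bullet> u k x))"
    by (simp add: lincomb_def inner_sum_left)
  also have "\<dots> = (\<Sum>i<r. d i * expectation (\<lambda>x. u i x \<bullet> u k x))"
    using u k by (subst Bochner_Integration.integral_sum) (auto simp: orthonormal_def intro!: integrable_inner)
  also have "\<dots> = (\<Sum>i<r. if i = k then d k else 0)"
    using u k by (intro sum.cong) (auto simp: orthonormal_def)
  finally show ?thesis using k by simp
qed

text \<open>Gram-Schmidt in \<open>L_2\<close>. Dependent generators are allowed: a zero residue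
  \<open>v\<close> is dropped, hence \<open>r \<le> n\<close>.\<close>

lemma exists_orthonormal:
  assumes "\<And>i. i < n \<Longrightarrow> b i \<in> X"
  shows "\<exists>r u. r \<le> n \<and> orthonormal r u \<and> (\<forall>c. \<exists>d. lincomb n c b = lincomb r d u)"
  using assms
proof (induction n)
  case 0
  then show ?case by (intro exI[of _ 0]) (auto simp: orthonormal_def lincomb_def)
next
  case (Suc n)
  then obtain r u where r: "r \<le> n" and u: "orthonormal r u"
    and span: "\<And>c. \<exists>d. lincomb n c b = lincomb r d u" by force
  have uX: "u i \<in> X" if "i < r" for i using u that by (auto simp: orthonormal_def)
  have bX: "b n \<in> X" using Suc.prems by simp
  define e where "e k = expectation (\<lambda>x. b n x \<bullet> u k x)" for k
  define v where "v = (\<lambda>x. b n x + (-1) *\<^sub>R lincomb r e u x)"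
  have vX: "v \<in> X" unfolding v_def by (intro add_mem scale_mem bX lincomb_mem uX)
  have vu: "expectation (\<lambda>x. v x \<bullet> u k x) = 0" if "k < r" for k
  proof -
    have "expectation (\<lambda>x. v x \<bullet> u k x)
        = expectation (\<lambda>x. b n x \<bullet> u k x - lincomb r e u x \<bullet> u k x)"
      by (simp add: v_def inner_diff_left)
    also have "\<dots> = e k - expectation (\<lambda>x. lincomb r e u x \<bullet> u k x)"
      unfolding e_def using uX that
      by (intro Bochner_Integration.integral_diff integrable_inner bX lincomb_mem) auto
    finally show ?thesis by (simp add: expectation_lincomb[OF u that])
  qed
  have b: "b n x = lincomb r e u x + v x" for x by (simp add: v_def)
  show ?case
  proof (cases "expectation (\<lambda>x. v x \<bullet> v x) = 0")
    case True
    then have v0: "v = (\<lambda>x. 0)" by (rule definite[OF vX])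
    have "\<exists>d. lincomb (Suc n) c b = lincomb r d u" for c
    proof -
      obtain d where d: "lincomb n c b = lincomb r d u" using span by blast
      have "lincomb (Suc n) c b x = lincomb n c b x + c n *\<^sub>R lincomb r e u x" for x
        using b[of x] v0 by (simp add: lincomb_def)
      also have "\<dots> x = lincomb r (\<lambda>i. d i + c n * e i) u x" for x
        unfolding d by (simp add: lincomb_def scaleR_add_left sum.distrib scaleR_sum_right)
      finally show ?thesis by blast
    qed
    then show ?thesis using r u by (intro exI[of _ r] exI[of _ u]) auto
  next
    case False
    moreover have "0 \<le> expectation (\<lambda>x. v x \<bullet> v x)" by simp
    ultimately have s: "0 < expectation (\<lambda>x. v x \<bullet> v x)" by linarith
    define s where "s = sqrt (expectation (\<lambda>x. v x \<bullet> v x))"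
    have s: "0 < s" "s * s = expectation (\<lambda>x. v x \<bullet> v x)" using s by (auto simp: s_def)
    define w where "w = u(r := \<lambda>x. (1 / s) *\<^sub>R v x)"
    have w: "orthonormal (Suc r) w"
      unfolding orthonormal_def
    proof (intro conjI allI impI)
      show "w i \<in> X" if "i < Suc r" for i
        using that uX vX by (auto simp: w_def less_Suc_eq intro: scale_mem)
      fix i k assume ik: "i < Suc r" "k < Suc r"
      show "expectation (\<lambda>x. w i x \<bullet> w k x) = (if i = k then 1 else 0)"
      proof (cases "i = r"; cases "k = r")
        assume "i \<noteq> r" "k \<noteq> r"
        then show ?thesis using ik u by (auto simp: w_def orthonormal_def less_Suc_eq)
      next
        assume "i = r" "k \<noteq> r"
        then show ?thesis using ik vu[of k] by (auto simp: w_def)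
      next
        assume "i \<noteq> r" "k = r"
        then show ?thesis using ik vu[of i] by (auto simp: w_def inner_commute)
      next
        assume "i = r" "k = r"
        then show ?thesis using s False by (simp add: w_def field_simps)
      qed
    qed
    have "\<exists>d. lincomb (Suc n) c b = lincomb (Suc r) d w" for c
    proof -
      obtain d where d: "lincomb n c b = lincomb r d u" using span by blast
      define d' where "d' i = (if i = r then c n * s else d i + c n * e i)" for i
      have "lincomb (Suc n) c b x = lincomb n c b x + c n *\<^sub>R (lincomb r e u x + v x)" for x
        using b[of x] by (simp add: lincomb_def)
      also have "\<dots> x = lincomb r (\<lambda>i. d i + c n * e i) u x + c n *\<^sub>R v x" for x
        unfolding d by (simp add: lincomb_def scaleR_add_left scaleR_add_right sum.distrib scaleR_sum_right)
      also have "\<dots> x = lincomb (Suc r) d' w x" for x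
        using s by (simp add: lincomb_def d'_def w_def)
      finally show ?thesis by blast
    qed
    then show ?thesis using r w by (intro exI[of _ "Suc r"] exI[of _ w]) auto
  qed
qed

text \<open>With \<open>s\<close> the supremum of \<open>norm (u x)\<close>, the \<open>q\<close>-th moment of \<open>u\<close> is at most \<open>s powr (q - 1)\<close> times the
  first moment, which is at most 1, so \<open>norm_le\<close> can be solved for \<open>s\<close>; this treats \<open>q \<le> 2\<close> and
  \<open>q > 2\<close> at once.\<close>

lemma norm_orthonormal_le:
  assumes u: "u \<in> X" "expectation (\<lambda>x. u x \<bullet> u x) = 1" and x: "x \<in> space M"
  shows "norm (u x) \<le> K powr q"
proof -
  obtain c where c: "\<And>x. x \<in> space M \<Longrightarrow> norm (u x) \<le> c" using bounded[OF u(1)] by blast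
  define s where "s = (SUP x\<in>space M. norm (u x))"
  have le_s: "norm (u x) \<le> s" if "x \<in> space M" for x
    unfolding s_def using that c by (intro cSUP_upper bdd_aboveI2[where M = c]) auto
  have s0: "0 \<le> s" using le_s[OF x] norm_ge_zero[of "u x"] by linarith
  have i1: "integrable M (\<lambda>x. norm (u x))" using integrable_powr[OF u(1), of 1] by simp
  have "expectation (\<lambda>x. norm (u x)) \<le> expectation (\<lambda>x. (1 + u x \<bullet> u x) / 2)"
  proof (intro integral_mono i1)
    show "norm (u x) \<le> (1 + u x \<bullet> u x) / 2" for x
      using zero_le_power2[of "norm (u x) - 1"]
      by (simp add: power2_diff dot_square_norm)
  qed (use integrable_inner[OF u(1) u(1)] in auto)
  also have "\<dots> = 1" using integrable_inner[OF u(1) u(1)] u(2) by (simp add: prob_space)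
  finally have L1: "expectation (\<lambda>x. norm (u x)) \<le> 1" .
  have "expectation (\<lambda>x. norm (u x) powr q) \<le> expectation (\<lambda>x. s powr (q - 1) * norm (u x))"
  proof (intro integral_mono integrable_powr u)
    show "norm (u x) powr q \<le> s powr (q - 1) * norm (u x)" if "x \<in> space M" for x
    proof -
      have "norm (u x) powr q = norm (u x) powr (q - 1) * norm (u x)"
        by (simp add: powr_diff)
      then show ?thesis using le_s[OF that] q_ge_1
        by (auto intro!: mult_right_mono powr_mono2)
    qed
  qed (use i1 q_ge_1 in auto)
  also have "\<dots> \<le> s powr (q - 1)"
    using L1 by (simp add: mult_left_le)
  finally have Lq: "expectation (\<lambda>x. norm (u x) powr q) \<le> s powr (q - 1)" .
  have "norm (u x) \<le> K * (s powr (q - 1)) powr (1 / q)" if "x \<in> space M" for x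
  proof (rule order_trans[OF norm_le[OF u(1) that]])
    show "K * expectation (\<lambda>x. norm (u x) powr q) powr (1 / q) \<le> K * (s powr (q - 1)) powr (1 / q)"
      using Lq K_ge_1 q_ge_1 by (intro mult_left_mono powr_mono2) (auto intro!: integral_nonneg_AE)
  qed
  then have "s \<le> K * (s powr (q - 1)) powr (1 / q)"
    unfolding s_def using x by (intro cSUP_least) auto
  then have "s powr q \<le> (K * (s powr (q - 1)) powr (1 / q)) powr q"
    using s0 q_ge_1 by (intro powr_mono2) auto
  also have "\<dots> = K powr q * s powr (q - 1)"
    using K_ge_1 q_ge_1 by (simp add: powr_mult powr_powr)
  finally have "s powr (q - 1) * s \<le> s powr (q - 1) * K powr q"
    using s0 by (simp add: powr_diff mult.commute)
  \<comment> \<open>The factor \<open>s powr (q - 1)\<close> cancels unless \<open>s = 0\<close>,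
    where the bound is immediate.\<close>
  then have "s \<le> K powr q"
    using s0 by (cases "s = 0") auto
  then show ?thesis using le_s[OF x] by linarith
qed

text \<open>Coefficients in an orthonormal basis are inner products, hence bounded by the product of
  the uniform bounds for \<open>f\<close> and for the basis functions. Rounding them to a grid
  leaves finitely many cells.\<close>

lemma exists_finite_net:
  assumes b: "\<And>i. i < n \<Longrightarrow> b i \<in> X" and span: "\<And>f. f \<in> X \<Longrightarrow> \<exists>c. f = lincomb n c b"
    and n: "1 \<le> n" and \<epsilon>: "0 < \<epsilon>"
  defines "A \<equiv> {f \<in> X. expectation (\<lambda>x. norm (f x) powr q) \<le> 1}"
  shows "\<exists>S. finite S \<and> S \<subseteq> A \<and> real (card S) \<le> (2 * K * (K powr q)\<^sup>2 * n / \<epsilon> + 3) ^ n \<and>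
    (\<forall>f\<in>A. \<exists>g\<in>S. \<forall>x\<in>space M. norm (f x - g x) \<le> \<epsilon>)"
proof -
  obtain r u where r: "r \<le> n" and u: "orthonormal r u"
    and span': "\<And>c. \<exists>d. lincomb n c b = lincomb r d u" using exists_orthonormal[of n b] b by blast
  have uX: "u i \<in> X" "expectation (\<lambda>x. u i x \<bullet> u i x) = 1" if "i < r" for i
    using u that by (auto simp: orthonormal_def)
  define U where "U = K powr q"
  have U: "1 \<le> U" using K_ge_1 q_ge_1 by (auto simp: U_def intro!: ge_one_powr_ge_zero)
  \<comment> \<open>At most \<open>n\<close> coefficient errors of size \<open>\<delta>\<close>,
    each multiplied by a function bounded by \<open>U\<close>, add up to
    \<open>\<epsilon>\<close>.\<close>
  define \<delta> where "\<delta> = \<epsilon> / (n * U)"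
  have \<delta>: "0 < \<delta>" "n * (\<delta> * U) = \<epsilon>" using U n \<epsilon> by (auto simp: \<delta>_def)
  have "\<forall>f\<in>X. \<exists>d. f = lincomb r d u" using span span' by metis
  then obtain d where d: "\<And>f. f \<in> X \<Longrightarrow> f = lincomb r (d f) u" by metis
  define y where "y = K * U / \<delta>"
  have y0: "0 \<le> y" using K_ge_1 U \<delta> by (simp add: y_def)
  have d_le: "\<bar>d f i\<bar> \<le> K * U" if f: "f \<in> A" and i: "i < r" for f i
  proof -
    have fX: "f \<in> X" and f1: "expectation (\<lambda>x. norm (f x) powr q) \<le> 1" using f by (auto simp: A_def)
    have fK: "norm (f x) \<le> K" if "x \<in> space M" for x
    proof -
      have "expectation (\<lambda>x. norm (f x) powr q) powr (1 / q) \<le> 1"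
        using f1 q_ge_1 by (intro powr_le1) auto
      then show ?thesis using norm_le[OF fX that] K_ge_1
        by (smt (verit) mult_left_le)
    qed
    have "d f i = expectation (\<lambda>x. f x \<bullet> u i x)"
      using expectation_lincomb[OF u i, of "d f"] d[OF fX] by simp
    also have "\<bar>\<dots>\<bar> \<le> expectation (\<lambda>x. \<bar>f x \<bullet> u i x\<bar>)" by (rule integral_abs_bound)
    also have "\<dots> \<le> expectation (\<lambda>x. K * U)"
    proof (intro integral_mono)
      show "integrable M (\<lambda>x. \<bar>f x \<bullet> u i x\<bar>)"
        using integrable_inner[OF fX uX(1)[OF i]] by (rule integrable_abs)
      show "\<bar>f x \<bullet> u i x\<bar> \<le> K * U" if "x \<in> space M" for x
      proof -
        have "\<bar>f x \<bullet> u i x\<bar> \<le> norm (f x) * norm (u i x)" by (rule Cauchy_Schwarz_ineq2)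
        also have "\<dots> \<le> K * U" using fK[OF that] norm_orthonormal_le[OF uX[OF i] that] K_ge_1
          by (intro mult_mono) (auto simp: U_def)
        finally show ?thesis .
      qed
    qed auto
    finally show ?thesis by (simp add: prob_space)
  qed
  \<comment> \<open>The cell of \<open>f\<close>. Each entry lies between the two ceilings, so it
    takes at most \<open>2 * y + 3\<close> values.\<close>
  define \<kappa> where "\<kappa> f = (\<lambda>i\<in>{..<r}. \<lfloor>d f i / \<delta>\<rfloor>)" for f
  have \<kappa>: "\<kappa> ` A \<subseteq> (\<Pi>\<^sub>E i\<in>{..<r}. {- \<lceil>y\<rceil>..\<lceil>y\<rceil>})"
  proof (intro image_subsetI PiE_I)
    fix f i assume f: "f \<in> A" and i: "i \<in> {..<r}"
    have "\<bar>d f i / \<delta>\<bar> \<le> y"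
      using d_le[OF f, of i] i \<delta> by (simp add: y_def divide_right_mono)
    then have "- y \<le> d f i / \<delta>" "d f i / \<delta> \<le> y" by linarith+
    then have "\<lfloor>- y\<rfloor> \<le> \<lfloor>d f i / \<delta>\<rfloor>" "\<lfloor>d f i / \<delta>\<rfloor> \<le> \<lceil>y\<rceil>"
      by (auto intro: floor_mono) linarith
    then show "\<kappa> f i \<in> {- \<lceil>y\<rceil>..\<lceil>y\<rceil>}" using i by (simp add: \<kappa>_def floor_minus)
  qed (auto simp: \<kappa>_def)
  have fin: "finite (\<kappa> ` A)" using \<kappa> by (rule finite_subset) (auto intro!: finite_PiE)
  have "real (card (\<kappa> ` A)) \<le> real (card (\<Pi>\<^sub>E i\<in>{..<r}. {- \<lceil>y\<rceil>..\<lceil>y\<rceil>}))"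
    using \<kappa> by (intro of_nat_mono card_mono) (auto intro!: finite_PiE)
  also have "\<dots> = real (nat (2 * \<lceil>y\<rceil> + 1)) ^ r" by (simp add: card_PiE)
  also have "\<dots> \<le> (2 * y + 3) ^ r"
    using y0 by (intro power_mono) linarith+
  also have "\<dots> \<le> (2 * y + 3) ^ n" using r y0 by (intro power_increasing) auto
  also have "2 * y = 2 * K * (K powr q)\<^sup>2 * n / \<epsilon>"
    by (simp add: y_def \<delta>_def U_def power2_eq_square)
  finally have card: "real (card (\<kappa> ` A)) \<le> (2 * K * (K powr q)\<^sup>2 * n / \<epsilon> + 3) ^ n" .
  have close: "norm (f x - g x) \<le> \<epsilon>" if f: "f \<in> A" and g: "g \<in> A" and eq: "\<kappa> f = \<kappa> g" and x: "x \<in> space M" for f g x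
  proof -
    have dd: "\<bar>d f i - d g i\<bar> \<le> \<delta>" if i: "i < r" for i
    proof -
      have "\<lfloor>d f i / \<delta>\<rfloor> = \<lfloor>d g i / \<delta>\<rfloor>" using fun_cong[OF eq, of i] i by (simp add: \<kappa>_def)
      then have "\<bar>d f i / \<delta> - d g i / \<delta>\<bar> \<le> 1" by linarith
      then show ?thesis using \<delta> by (simp add: diff_divide_distrib[symmetric] abs_divide)
    qed
    have "f x - g x = lincomb r (d f) u x - lincomb r (d g) u x"
      using d f g by (metis (no_types, lifting) A_def mem_Collect_eq)
    also have "\<dots> = (\<Sum>i<r. (d f i - d g i) *\<^sub>R u i x)"
      by (simp add: lincomb_def sum_subtractf scaleR_diff_left)
    also have "norm \<dots> \<le> (\<Sum>i<r. \<delta> * U)"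
    proof (rule sum_norm_le)
      fix i assume "i \<in> {..<r}"
      then have i: "i < r" by simp
      have "norm ((d f i - d g i) *\<^sub>R u i x) = \<bar>d f i - d g i\<bar> * norm (u i x)" by simp
      also have "\<dots> \<le> \<delta> * U"
        using dd[OF i] norm_orthonormal_le[OF uX[OF i] x] \<delta> by (intro mult_mono) (auto simp: U_def)
      finally show "norm ((d f i - d g i) *\<^sub>R u i x) \<le> \<delta> * U" .
    qed
    also have "\<dots> = r * (\<delta> * U)" by simp
    also have "\<dots> \<le> n * (\<delta> * U)" using r \<delta>(1) U by (intro mult_right_mono) auto
    finally show ?thesis unfolding \<delta>(2) .
  qed
  \<comment> \<open>Grid points may lie outside \<open>A\<close>, so each occupied cell is
    represented by one of its members.\<close>
  define S where "S = inv_into A \<kappa> ` (\<kappa> ` A)"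
  have SA: "S \<subseteq> A" unfolding S_def by (intro image_subsetI inv_into_into)
  show ?thesis
  proof (intro exI[of _ S] conjI ballI)
    show "finite S" using fin by (simp add: S_def)
    show "S \<subseteq> A" by (rule SA)
    have "real (card S) \<le> real (card (\<kappa> ` A))"
      unfolding S_def by (intro of_nat_mono card_image_le fin)
    then show "real (card S) \<le> (2 * K * (K powr q)\<^sup>2 * n / \<epsilon> + 3) ^ n"
      using card by (rule order_trans)
    fix f assume f: "f \<in> A"
    let ?g = "inv_into A \<kappa> (\<kappa> f)"
    show "\<exists>g\<in>S. \<forall>x\<in>space M. norm (f x - g x) \<le> \<epsilon>"
    proof (intro bexI ballI)
      show gS: "?g \<in> S" using f by (simp add: S_def)
      show "norm (f x - ?g x) \<le> \<epsilon>" if "x \<in> space M" for x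
        using f gS SA that by (intro close) (auto simp: f_inv_into_f)
    qed
  qed
qed

end

section \<open>Consequences of the entropy bound\<close>

text \<open>An entropy number is an infimum that need not be attained, so a cover exists only for
  radii strictly above the bound.\<close>

lemma entropy_number_cover:
  assumes ent: "entropy_number k A Y nrm \<le> ereal b" and "b < \<epsilon>"
  obtains S where "finite S" "S \<subseteq> A" "card S \<le> 2 ^ k" "\<And>g. g \<in> A \<Longrightarrow> \<exists>f\<in>S. nrm (f - g) \<le> \<epsilon>"
proof -
  have "entropy_number k A Y nrm < ereal \<epsilon>" using assms by (auto intro: le_less_trans)
  then obtain \<epsilon>' where \<epsilon>': "\<epsilon>' < \<epsilon>" "metric_entropy \<epsilon>' A Y nrm \<le> ereal (real k)"
    unfolding entropy_number_def Inf_less_iff by auto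
  let ?C = "{enat n | n. \<exists>f :: nat \<Rightarrow> 'a. (\<forall>j\<in>{1..n}. f j \<in> A) \<and>
                        A \<subseteq> (\<Union>j\<in>{1..n}. normed_ball Y nrm (f j) \<epsilon>')}"
  obtain n where n: "covering_number \<epsilon>' A Y nrm = enat n" "log 2 (real n) \<le> real k"
    using \<epsilon>'(2) unfolding metric_entropy_def by (cases "covering_number \<epsilon>' A Y nrm") auto
  \<comment> \<open>A finite infimum excludes the empty set, and in the well-ordered type
    \<open>enat\<close> the infimum of a nonempty set is attained.\<close>
  have "?C \<noteq> {}"
  proof
    assume "?C = {}"
    then have "covering_number \<epsilon>' A Y nrm = Inf {}" by (simp only: covering_number_def)
    then show False using n(1) by (simp add: Inf_enat_def)
  qed
  then have "covering_number \<epsilon>' A Y nrm \<in> ?C"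
    unfolding covering_number_def by (intro wellorder_InfI[of "SOME x. x \<in> ?C"]) (rule someI_ex, blast)
  then obtain f where f: "\<forall>j\<in>{1..n}. f j \<in> A" "A \<subseteq> (\<Union>j\<in>{1..n}. normed_ball Y nrm (f j) \<epsilon>')"
    using n(1) by auto
  show thesis
  proof (rule that)
    show "finite (f ` {1..n})" "f ` {1..n} \<subseteq> A" using f(1) by auto
    \<comment> \<open>The logarithm can be inverted only for positive \<open>n\<close>; zero balls
      occur when \<open>A\<close> is empty.\<close>
    have "n \<le> 2 ^ k"
    proof (cases "n = 0")
      case False
      then have "real n \<le> 2 powr real k" using n(2) by (simp add: log_le_iff)
      then have "real n \<le> real (2 ^ k)" by (simp add: powr_realpow)
      then show ?thesis by (simp only: of_nat_le_iff)
    qed simp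
    then show "card (f ` {1..n}) \<le> 2 ^ k"
      using card_image_le[of "{1..n}" f] by simp
    show "\<exists>h\<in>f ` {1..n}. nrm (h - g) \<le> \<epsilon>" if g: "g \<in> A" for g
    proof -
      obtain j where "j \<in> {1..n}" "nrm (f j - g) \<le> \<epsilon>'"
        using f(2) g unfolding normed_ball_def by blast
      then show ?thesis using \<epsilon>'(1) by (intro bexI[of _ "f j"]) auto
    qed
  qed
qed

lemma compactin_Euclidean_space_imp_compact:
  "compactin (Euclidean_space d) \<Omega> \<Longrightarrow> compact \<Omega>"
  by (simp add: Euclidean_space_def compactin_subtopology euclidean_product_topology)

lemma norm_le_sup_norm:
  assumes "compact \<Omega>" "f \<in> cont_functions \<Omega>" "x \<in> \<Omega>"
  shows "norm (f x) \<le> sup_norm \<Omega> f"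
proof -
  have "compact ((\<lambda>x. norm (f x)) ` \<Omega>)"
    using assms by (intro compact_continuous_image continuous_on_norm) (auto simp: cont_functions_def)
  then have "bdd_above ((\<lambda>x. norm (f x)) ` \<Omega>)"
    by (intro bounded_imp_bdd_above compact_imp_bounded)
  then show ?thesis unfolding sup_norm_def using assms(3) by (intro cSUP_upper)
qed

lemma cont_functions_diff:
  "f \<in> cont_functions \<Omega> \<Longrightarrow> g \<in> cont_functions \<Omega> \<Longrightarrow> f - g \<in> cont_functions \<Omega>"
  by (auto simp: cont_functions_def fun_diff_def intro: continuous_on_diff)

text \<open>The crude net is polynomial in \<open>B * N\<close> for fixed \<open>q\<close>, so its
  entropy per dimension is one logarithm. The mesh \<open>a / 16\<close> belongs to the lowest
  level.\<close>

lemma ln_net_bound: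
  fixes q a B :: real and n N :: nat
  assumes q: "1 \<le> q" and a: "0 < a" "a \<le> 1" and B: "1 \<le> B" and N: "1 \<le> N" and n: "n \<le> 2 * N"
  defines "K \<equiv> 4 * B * real N powr (1 / q)"
  shows "ln (2 * K * (K powr q)\<^sup>2 * n / (a / 16) + 3)
    \<le> (ln (67 * 64 powr q / a) + 3 * q + 4) * log 2 (2 * B * N)"
proof -
  define U where "U = K powr q"
  have rN: "1 \<le> real N" using N by simp
  have K: "1 \<le> K" unfolding K_def
    using B rN q mult_mono[of 1 B 1 "real N powr (1 / q)"] by (auto simp: ge_one_powr_ge_zero)
  have KU: "K \<le> U" using powr_mono[of 1 q K] K q by (simp add: U_def)
  have U: "U = 4 powr q * B powr q * N"
    using B q by (simp add: U_def K_def powr_mult powr_powr)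
  have U1: "1 \<le> U" using K KU by linarith
  define Y where "Y = 2 * B * real N"
  have BN: "B \<le> Y" "real N \<le> Y" "2 \<le> Y"
    unfolding Y_def using B rN mult_mono[of 1 B 1 "real N"] mult_left_mono[of 1 "real N" B]
      mult_right_mono[of 1 B "real N"] by auto
  have "2 * K * U\<^sup>2 * n / (a / 16) = 32 * (K * U\<^sup>2 * n) / a"
    using a by simp
  also have "\<dots> \<le> 32 * (U * U\<^sup>2 * (2 * N)) / a"
  proof -
    have "real n \<le> 2 * real N" using n by linarith
    then have *: "K * U\<^sup>2 * n \<le> U * U\<^sup>2 * (2 * N)"
      using KU K U1 by (intro mult_mono) auto
    then show ?thesis using a by (intro divide_right_mono mult_left_mono *) auto
  qed
  also have "\<dots> = 64 * (U ^ 3 * N / a)" by (simp add: power3_eq_cube power2_eq_square)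
  finally have 1: "2 * K * U\<^sup>2 * n / (a / 16) \<le> 64 * (U ^ 3 * N / a)" .
  have "1 * 1 \<le> U ^ 3 * N" using U1 rN by (intro mult_mono one_le_power) auto
  then have "1 \<le> U ^ 3 * N / a" using a by (simp add: le_divide_eq)
  with 1 have "2 * K * U\<^sup>2 * n / (a / 16) + 3 \<le> 67 * (U ^ 3 * N / a)" by linarith
  \<comment> \<open>\<open>U ^ 3\<close> contributes \<open>B powr (3 * q)\<close> and three factors
    \<open>N\<close>; with the remaining \<open>N\<close> this yields the exponent
    \<open>3 * q + 4\<close>.\<close>
  also have "U ^ 3 * N = 64 powr q * ((B powr q) ^ 3 * real N ^ 4)"
  proof -
    have "(4 powr q) ^ 3 = (4 ^ 3 :: real) powr q"
      by (simp add: power3_eq_cube powr_mult[symmetric])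
    then show ?thesis by (simp add: U power_mult_distrib power3_eq_cube eval_nat_numeral)
  qed
  also have "\<dots> \<le> 64 powr q * (Y powr (3 * q) * Y powr 4)"
  proof -
    have "(B powr q) ^ 3 = B powr (3 * q)" by (simp add: power3_eq_cube flip: powr_add)
    also have "\<dots> \<le> Y powr (3 * q)" using B BN q by (intro powr_mono2) auto
    finally have "(B powr q) ^ 3 \<le> Y powr (3 * q)" .
    moreover have "real N ^ 4 \<le> Y powr 4" using BN rN by (simp add: powr_numeral power_mono)
    ultimately show ?thesis by (intro mult_left_mono mult_mono) auto
  qed
  also have "Y powr (3 * q) * Y powr 4 = Y powr (3 * q + 4)" by (simp add: powr_add)
  finally have "2 * K * U\<^sup>2 * n / (a / 16) + 3 \<le> 67 * 64 powr q / a * Y powr (3 * q + 4)"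
    using a by (simp add: divide_right_mono field_simps)
  moreover have "0 < 2 * K * U\<^sup>2 * n / (a / 16) + 3" using K a by (intro add_nonneg_pos) auto
  ultimately have "ln (2 * K * U\<^sup>2 * n / (a / 16) + 3) \<le> ln (67 * 64 powr q / a * Y powr (3 * q + 4))"
    by simp
  also have "\<dots> = ln (67 * 64 powr q / a) + (3 * q + 4) * ln Y"
    using a BN by (subst ln_mult) (auto simp: ln_powr)
  also have "\<dots> \<le> ln (67 * 64 powr q / a) * log 2 Y + (3 * q + 4) * log 2 Y"
  proof (intro add_mono mult_left_mono)
    have "1 * 1 \<le> 67 * 64 powr q" using q by (intro mult_mono ge_one_powr_ge_zero) auto
    then have "0 \<le> ln (67 * 64 powr q / a)" using a by (intro ln_ge_zero) (simp add: le_divide_eq)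
    moreover have "1 \<le> log 2 Y" using BN by (simp add: le_log_iff)
    ultimately show "ln (67 * 64 powr q / a) \<le> ln (67 * 64 powr q / a) * log 2 Y"
      using mult_left_mono[of 1 "log 2 Y"] by fastforce
    have "ln Y * ln 2 \<le> ln Y * 1" using BN ln_2_less_1 by (intro mult_left_mono) auto
    then show "ln Y \<le> log 2 Y" by (simp add: log_def le_divide_eq)
    show "0 \<le> 3 * q + 4" using q by simp
  qed
  finally show ?thesis by (simp add: U_def Y_def algebra_simps)
qed

text \<open>The entropy bound at \<open>k = 1\<close>, combined with the symmetry of the unit ball,
  gives a uniform bound \<open>2 * r\<close> on that ball; homogeneity extends it to the Nikolskii
  inequality on \<open>X\<close>.\<close>

lemma entropy_setting_real_function_space:
  fixes X :: "((nat \<Rightarrow> real) \<Rightarrow> 'k::{real_normed_field, euclidean_space}) set"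
  assumes q: "1 \<le> q" and set: "entropy_setting q d \<Omega> \<mu> X N B"
  shows "real_function_space \<mu> X q (4 * B * real N powr (1 / q))"
proof -
  have X: "X \<subseteq> cont_functions \<Omega>" "fun_vs.subspace X" and N: "1 \<le> N" and B: "1 \<le> B"
    and sets: "sets \<mu> = sets (restrict_space borel \<Omega>)"
    and compact: "compact \<Omega>"
    and ent: "entropy_number 1 (Lq_unit_ball \<mu> q X) (cont_functions \<Omega>) (sup_norm \<Omega>)
      \<le> ereal (B * real N powr (1 / q))"
    using set compactin_Euclidean_space_imp_compact unfolding entropy_setting_def by force+
  interpret prob_space \<mu> using set unfolding entropy_setting_def by blast
  have space: "space \<mu> = \<Omega>" using sets_eq_imp_space_eq[OF sets] by (simp add: space_restrict_space)
  \<comment> \<open>The factor 2 makes \<open>r\<close> strictly larger than the entropy bound, as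
    \<open>entropy_number_cover\<close> requires.\<close>
  define r where "r = 2 * B * real N powr (1 / q)"
  have rN: "1 \<le> real N powr (1 / q)" using N q by (intro ge_one_powr_ge_zero) auto
  have "0 < B * real N powr (1 / q)" using B rN by (intro mult_pos_pos) linarith+
  then have r0: "0 < r" "B * real N powr (1 / q) < r" unfolding r_def by linarith+
  have zero: "(\<lambda>x. 0) \<in> X"
    using fun_vs.subspace_0[OF X(2)] by (simp add: zero_fun_def)
  have scale: "(\<lambda>x. c *\<^sub>R f x) \<in> X" if "f \<in> X" for f c
    using fun_vs.subspace_scale[OF X(2) that, of "of_real c"] by (simp add: fun_scale_def scaleR_conv_of_real)
  obtain S where S: "finite S" "S \<subseteq> Lq_unit_ball \<mu> q X" "card S \<le> 2 ^ 1"
    "\<And>g. g \<in> Lq_unit_ball \<mu> q X \<Longrightarrow> \<exists>f\<in>S. sup_norm \<Omega> (f - g) \<le> r"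
    using entropy_number_cover[OF ent r0(2)] by blast
  \<comment> \<open>Two balls of radius \<open>r\<close> cover \<open>0\<close>, \<open>f\<close> and \<open>-f\<close>, so two of these lie in the same ball.\<close>
  have bound: "norm (f x) \<le> 2 * r" if f: "f \<in> Lq_unit_ball \<mu> q X" and x: "x \<in> \<Omega>" for f x
  proof -
    have fX: "f \<in> X" using f by (simp add: Lq_unit_ball_def)
    have near: "\<exists>c\<in>S. norm (c x - s *\<^sub>R f x) \<le> r" if s: "\<bar>s\<bar> \<in> {0, 1}" for s
    proof -
      have "(\<lambda>x. s *\<^sub>R f x) \<in> Lq_unit_ball \<mu> q X"
        using s f scale[OF fX] q unfolding Lq_unit_ball_def Lq_norm_def by auto
      then obtain c where c: "c \<in> S" "sup_norm \<Omega> (c - (\<lambda>x. s *\<^sub>R f x)) \<le> r" using S(4) by blast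
      have "c - (\<lambda>x. s *\<^sub>R f x) \<in> cont_functions \<Omega>"
        using c(1) S(2) X(1) scale[OF fX] by (intro cont_functions_diff) (auto simp: Lq_unit_ball_def)
      from norm_le_sup_norm[OF compact this x] c show ?thesis
        by (intro bexI[of _ c]) (auto simp: fun_diff_def)
    qed
    obtain c0 where c0: "c0 \<in> S" "norm (c0 x) \<le> r" using near[of 0] by auto
    obtain c1 where c1: "c1 \<in> S" "norm (c1 x - f x) \<le> r" using near[of 1] by auto
    obtain c2 where c2: "c2 \<in> S" "norm (c2 x + f x) \<le> r" using near[of "-1"] by auto
    have "card {c0, c1, c2} \<le> 2"
      using card_mono[OF S(1), of "{c0, c1, c2}"] S(3) c0 c1 c2 by simp
    then consider "c0 = c1" | "c0 = c2" | "c1 = c2"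
      by (cases "c0 = c1"; cases "c0 = c2"; cases "c1 = c2") auto
    then show ?thesis
    proof cases
      case 1
      then show ?thesis using norm_triangle_ineq4[of "c0 x" "c1 x - f x"] c0 c1 by simp
    next
      case 2
      then show ?thesis using norm_triangle_ineq4[of "c2 x + f x" "c0 x"] c0 c2 by simp
    next
      case 3
      have "norm (2 *\<^sub>R f x) \<le> 2 * r"
        using 3 norm_triangle_ineq4[of "c2 x + f x" "c1 x - f x"] c1 c2 by (simp add: scaleR_2)
      then show ?thesis using r0 by simp
    qed
  qed
  show ?thesis
  proof (unfold_locales)
    show "(\<lambda>x. 0) \<in> X" by (rule zero)
    show "(\<lambda>x. f x + g x) \<in> X" if "f \<in> X" "g \<in> X" for f g
      using fun_vs.subspace_add[OF X(2) that] by (simp add: plus_fun_def)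
    show "(\<lambda>x. c *\<^sub>R f x) \<in> X" if "f \<in> X" for f c by (rule scale[OF that])
    show "f \<in> borel_measurable \<mu>" if "f \<in> X" for f
    proof -
      have "f \<in> borel_measurable (restrict_space borel \<Omega>)"
        using that X(1) by (intro borel_measurable_continuous_on_restrict) (auto simp: cont_functions_def)
      then show ?thesis by (simp cong: measurable_cong_sets add: sets)
    qed
    show "f x = 0" if "f \<in> X" "x \<notin> space \<mu>" for f x
      using that X(1) by (auto simp: cont_functions_def space)
    show "1 \<le> q" by (rule q)
    show "1 \<le> 4 * B * real N powr (1 / q)" using mult_mono[of 1 B 1 "real N powr (1 / q)"] B rN by auto
    fix f x assume f: "f \<in> X" and x: "x \<in> space \<mu>"
    define I where "I = expectation (\<lambda>x. norm (f x) powr q)"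
    have I0: "0 \<le> I" by (simp add: I_def integral_nonneg_AE)
    have scaled: "s * norm (f x) \<le> 2 * r" if s: "0 \<le> s" "s powr q * I \<le> 1" for s
    proof -
      have "(\<integral>x. norm (s *\<^sub>R f x) powr q \<partial>\<mu>) = s powr q * I"
        using s by (simp add: I_def powr_mult)
      then have "(\<lambda>x. s *\<^sub>R f x) \<in> Lq_unit_ball \<mu> q X"
        using scale[OF f] s I0 q by (auto simp: Lq_unit_ball_def Lq_norm_def intro!: powr_le1)
      then show ?thesis using bound[of "\<lambda>x. s *\<^sub>R f x" x] x s by (simp add: space)
    qed
    have r2: "2 * r = 4 * B * real N powr (1 / q)" by (simp add: r_def)
    have "norm (f x) \<le> 2 * r * I powr (1 / q)"
    proof (cases "I = 0")
      case True
      have "norm (f x) = 0"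
      proof (rule ccontr)
        assume n0: "norm (f x) \<noteq> 0"
        \<comment> \<open>All multiples of a function of norm zero lie in the unit ball, so one with
          value \<open>3 * r\<close> at \<open>x\<close> would break the uniform bound.\<close>
        have "(3 * r / norm (f x)) * norm (f x) \<le> 2 * r"
          using True r0 by (intro scaled) auto
        then show False using n0 r0 by simp
      qed
      then show ?thesis using r0 by simp
    next
      case False
      then have I: "0 < I" using I0 by simp
      have "(1 / I powr (1 / q)) * norm (f x) \<le> 2 * r"
        using I q by (intro scaled) (auto simp: powr_divide powr_powr)
      then show ?thesis using I by (simp add: divide_le_eq mult.commute)
    qed
    then show "norm (f x) \<le> 4 * B * real N powr (1 / q) * expectation (\<lambda>x. norm (f x) powr q) powr (1 / q)"
      unfolding r2 I_def .
  qed
qed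

section \<open>The number of points\<close>

text \<open>The mesh relative to the level that \<open>layer_approximation\<close> demands.\<close>

definition net_scale :: "real \<Rightarrow> real"
  where "net_scale q = 1 / (32 * q * 4 powr q)"

text \<open>The factor delivered by \<open>ln_net_bound\<close> in front of the logarithm.\<close>

definition coarse_exponent :: "real \<Rightarrow> real"
  where "coarse_exponent q = ln (67 * 64 powr q / net_scale q) + 3 * q + 4"

text \<open>\<open>28 * 8 powr q\<close> pays for the union over the layers, the 7 for the nets
  given by the entropy hypothesis, and \<open>4 * coarse_exponent q\<close> for the crude
  nets.\<close>

definition budget_constant :: "real \<Rightarrow> real"
  where "budget_constant q = 28 * 8 powr q + (7 + 4 * coarse_exponent q) * (2 / net_scale q) powr q"

lemma net_scale_bounds:
  assumes "1 \<le> q" shows "0 < net_scale q" "net_scale q \<le> 1"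
proof -
  have "1 * 1 * 1 \<le> 32 * q * 4 powr q"
    using assms by (intro mult_mono ge_one_powr_ge_zero) auto
  then show "0 < net_scale q" "net_scale q \<le> 1" using assms by (auto simp: net_scale_def)
qed

lemma coarse_exponent_nonneg:
  assumes "1 \<le> q" shows "0 \<le> coarse_exponent q"
proof -
  have "1 * 1 \<le> 67 * 64 powr q" using assms by (intro mult_mono ge_one_powr_ge_zero) auto
  then have "0 \<le> ln (67 * 64 powr q / net_scale q)"
    using net_scale_bounds[OF assms] by (intro ln_ge_zero) (simp add: le_divide_eq)
  then show ?thesis using assms by (simp add: coarse_exponent_def)
qed

lemma budget_constant_ge_1:
  assumes "1 \<le> q" shows "1 \<le> budget_constant q"
proof -
  have "1 * 1 \<le> 28 * 8 powr q" using assms by (intro mult_mono ge_one_powr_ge_zero) auto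
  moreover have "0 \<le> (7 + 4 * coarse_exponent q) * (2 / net_scale q) powr q"
    using coarse_exponent_nonneg[OF assms] by simp
  ultimately show ?thesis unfolding budget_constant_def by linarith
qed

text \<open>Above the threshold the level cancels against the entropy, so each layer costs the same
  and the sum brings a factor \<open>J\<close>. Below it the entropy bound is fixed and the levels
  form a geometric series, so \<open>L\<close> comes from the entropy alone. The second factor
  \<open>L\<close> comes from dividing by \<open>l\<close>.\<close>

lemma chaining_budget:
  fixes q B L :: real and N J m :: nat and c :: "nat \<Rightarrow> real"
  assumes q: "1 \<le> q" and B: "1 \<le> B" and N: "1 \<le> N" and L: "1 \<le> L"
    and J: "1 \<le> J" "real J \<le> 7 * L" "dyadic_level J powr q \<le> 8 powr q * (N * B powr q)"
    and c: "\<And>j. j \<in> {1..J} \<Longrightarrow> 1 \<le> c j"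
    and ln_c: "\<And>j. j \<in> {1..J} \<Longrightarrow> ln (c j) \<le> (if dyadic_level j \<le> 2 * B / net_scale q
      then 2 * real N * coarse_exponent q * L else real N * (2 * B / (net_scale q * dyadic_level j)) powr q + 1)"
    and m: "7168 * budget_constant q * (N * B powr q) * L\<^sup>2 \<le> m"
  defines "l \<equiv> 1 / (32 * real J)"
  shows "(\<Sum>j=1..J. l + dyadic_level j powr q * ln (2 * real J * c j) / (real m * l)) \<le> 1 / 16"
proof -
  let ?t = "\<lambda>j. dyadic_level j powr q"
  define NB where "NB = N * B powr q"
  define a where "a = net_scale q"
  define D where "D = coarse_exponent q"
  have a: "0 < a" "a \<le> 1" using net_scale_bounds[OF q] by (auto simp: a_def)
  have D: "0 \<le> D" using coarse_exponent_nonneg[OF q] by (simp add: D_def)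
  have "1 * 1 \<le> real N * B powr q" using N B q by (intro mult_mono ge_one_powr_ge_zero) auto
  then have NB: "1 \<le> NB" by (simp add: NB_def)
  have Ba: "(2 * B / a) powr q = (2 / a) powr q * B powr q"
    using a B by (simp add: powr_mult powr_divide)
  have layer: "?t j * ln (2 * real J * c j) \<le> 2 * J * ?t j + (2 / a) powr q * NB
      + 2 * real N * D * L * (if dyadic_level j \<le> 2 * B / a then ?t j else 0)" if j: "j \<in> {1..J}" for j
  proof -
    \<comment> \<open>This crude bound is affordable since it multiplies a geometric series. Its
      \<open>-1\<close> absorbs the \<open>+1\<close> in \<open>ln_c\<close>.\<close>
    have "ln (2 * real J) \<le> 2 * real J - 1" using J by (intro ln_le_minus_one) auto
    then have "ln (2 * real J * c j) \<le> 2 * real J - 1 + ln (c j)"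
      using c[OF j] J by (subst ln_mult) auto
    then have 1: "?t j * ln (2 * real J * c j) \<le> 2 * J * ?t j + ?t j * (ln (c j) - 1)"
      using mult_left_mono[of "ln (2 * real J * c j)" "2 * real J - 1 + ln (c j)" "?t j"]
      by (simp add: algebra_simps)
    show ?thesis
    proof (cases "dyadic_level j \<le> 2 * B / a")
      case True
      have "?t j * (ln (c j) - 1) \<le> ?t j * (2 * real N * D * L)"
        using ln_c[OF j] True by (intro mult_left_mono) (auto simp: a_def D_def)
      also have "\<dots> = 2 * real N * D * L * ?t j" by (rule mult.commute)
      finally have "?t j * (ln (c j) - 1) \<le> 2 * real N * D * L * ?t j" .
      moreover have "0 \<le> (2 / a) powr q * NB" using NB by simp
      ultimately show ?thesis unfolding if_P[OF True] using 1 by linarith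
    next
      case False
      have "?t j * (ln (c j) - 1) \<le> ?t j * (N * (2 * B / (a * dyadic_level j)) powr q)"
        using ln_c[OF j] False by (intro mult_left_mono) (auto simp: a_def)
      also have "\<dots> = N * (2 * B / a) powr q"
        using a B by (simp add: powr_mult powr_divide)
      also have "\<dots> = (2 / a) powr q * NB" by (simp add: Ba NB_def)
      finally show ?thesis using 1 False by simp
    qed
  qed
  have "(\<Sum>j=1..J. ?t j * ln (2 * real J * c j)) \<le> (\<Sum>j=1..J. 2 * J * ?t j + (2 / a) powr q * NB
      + 2 * real N * D * L * (if dyadic_level j \<le> 2 * B / a then ?t j else 0))"
    by (intro sum_mono layer)
  also have "\<dots> = 2 * J * (\<Sum>j=1..J. ?t j) + J * ((2 / a) powr q * NB)
      + 2 * real N * D * L * (\<Sum>j=1..J. if dyadic_level j \<le> 2 * B / a then ?t j else 0)"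
    by (simp only: sum.distrib sum_distrib_left sum_constant) simp
  also have "\<dots> \<le> 2 * J * (2 * (8 powr q * NB)) + J * ((2 / a) powr q * NB)
      + 2 * real N * D * L * (2 * (2 * B / a) powr q)"
  proof (intro add_mono mult_left_mono order_refl)
    show "(\<Sum>j=1..J. ?t j) \<le> 2 * (8 powr q * NB)"
      using sum_dyadic_level_le[OF q, of J] J(3) by (simp add: NB_def)
    show "(\<Sum>j=1..J. if dyadic_level j \<le> 2 * B / a then ?t j else 0) \<le> 2 * (2 * B / a) powr q"
      using a B by (intro sum_dyadic_level_upto_le q) auto
  qed (use D L in auto)
  also have "2 * real N * D * L * (2 * (2 * B / a) powr q) = 4 * D * L * ((2 / a) powr q * NB)"
    by (simp add: Ba NB_def)
  also have "2 * J * (2 * (8 powr q * NB)) \<le> 2 * (7 * L) * (2 * (8 powr q * NB))"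
    using J NB by (intro mult_right_mono mult_left_mono) auto
  also have "J * ((2 / a) powr q * NB) \<le> 7 * L * ((2 / a) powr q * NB)"
    using J NB by (intro mult_right_mono) auto
  finally have W: "(\<Sum>j=1..J. ?t j * ln (2 * real J * c j)) \<le> budget_constant q * NB * L"
    by (simp add: budget_constant_def a_def D_def algebra_simps)
  have E: "1 \<le> budget_constant q" by (rule budget_constant_ge_1[OF q])
  then have E0: "0 < budget_constant q * NB * L\<^sup>2" using NB L by (intro mult_pos_pos) auto
  then have m0: "0 < real m" using m unfolding NB_def[symmetric] by linarith
  have "(\<Sum>j=1..J. l + ?t j * ln (2 * real J * c j) / (real m * l))
      = J * l + (\<Sum>j=1..J. ?t j * ln (2 * real J * c j)) / (real m * l)"
    by (simp add: sum.distrib sum_divide_distrib)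
  also have "J * l = 1 / 32" using J by (simp add: l_def)
  also have "(\<Sum>j=1..J. ?t j * ln (2 * real J * c j)) / (real m * l) \<le> budget_constant q * NB * L / (real m * l)"
    using W m0 J by (intro divide_right_mono) (auto simp: l_def)
  also have "\<dots> = 32 * J * (budget_constant q * NB * L) / m"
    by (simp add: l_def)
  also have "\<dots> \<le> 32 * (7 * L) * (budget_constant q * NB * L) / m"
    using J E NB L m0 by (intro divide_right_mono mult_right_mono mult_left_mono) auto
  \<comment> \<open>Here \<open>224 = 32 * 7\<close>, and 7168 in the hypothesis on \<open>m\<close>
    is \<open>32 * 224\<close>.\<close>
  also have "\<dots> = 224 * (budget_constant q * NB * L\<^sup>2) / m" by (simp add: power2_eq_square)
  also have "\<dots> \<le> 1 / 32"
    using m m0 unfolding NB_def[symmetric] by (simp add: divide_le_eq mult.assoc)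
  finally show ?thesis by simp
qed

section \<open>From nets of the unit ball to the discretization of the space\<close>

text \<open>By the reverse triangle inequality, taking moduli preserves a net and does not enlarge
  it.\<close>

lemma (in real_function_space) exists_norm_net:
  assumes S: "finite S" "S \<subseteq> {f \<in> X. expectation (\<lambda>x. norm (f x) powr q) \<le> 1}"
    and card: "ln (card S) \<le> h"
    and cover: "\<And>f. f \<in> X \<Longrightarrow> expectation (\<lambda>x. norm (f x) powr q) \<le> 1
      \<Longrightarrow> \<exists>g\<in>S. \<forall>x\<in>space M. norm (f x - g x) \<le> \<epsilon>"
  defines "A \<equiv> (\<lambda>f x. norm (f x)) ` {f \<in> X. expectation (\<lambda>x. norm (f x) powr q) \<le> 1}"
  shows "\<exists>T. finite T \<and> T \<noteq> {} \<and> T \<subseteq> A \<and> ln (card T) \<le> h \<and>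
    (\<forall>f\<in>A. \<exists>g\<in>T. \<forall>x\<in>space M. \<bar>f x - g x\<bar> \<le> \<epsilon>)"
proof (intro exI[of _ "(\<lambda>f x. norm (f x)) ` S"] conjI ballI)
  let ?T = "(\<lambda>f x. norm (f x)) ` S"
  show "finite ?T" "?T \<subseteq> A" using S by (auto simp: A_def)
  have "\<exists>g. g \<in> S" using cover[OF zero_mem] by auto
  then show "?T \<noteq> {}" by blast
  then have "0 < card ?T" using S(1) by (simp add: card_gt_0_iff)
  moreover have "card ?T \<le> card S" by (rule card_image_le[OF S(1)])
  ultimately have "ln (card ?T) \<le> ln (card S)" by simp
  then show "ln (card ?T) \<le> h" using card by linarith
  fix f assume "f \<in> A"
  then obtain f' where f': "f = (\<lambda>x. norm (f' x))" "f' \<in> X" "expectation (\<lambda>x. norm (f' x) powr q) \<le> 1"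
    unfolding A_def by blast
  obtain g where g: "g \<in> S" "\<And>x. x \<in> space M \<Longrightarrow> norm (f' x - g x) \<le> \<epsilon>" using cover[OF f'(2,3)] by blast
  show "\<exists>g\<in>?T. \<forall>x\<in>space M. \<bar>f x - g x\<bar> \<le> \<epsilon>"
  proof (intro bexI ballI)
    show "\<bar>f x - norm (g x)\<bar> \<le> \<epsilon>" if "x \<in> space M" for x
      using g(2)[OF that] norm_triangle_ineq3[of "f' x" "g x"] unfolding f' by linarith
  qed (use g in auto)
qed

lemma entropy_setting_nets:
  fixes X :: "((nat \<Rightarrow> real) \<Rightarrow> 'k::{real_normed_field, euclidean_space}) set"
  assumes q: "1 \<le> q" and set: "entropy_setting q d \<Omega> \<mu> X N B"
    and b: "\<And>i. i < n \<Longrightarrow> b i \<in> X" and span: "\<And>f. f \<in> X \<Longrightarrow> \<exists>c. f = lincomb n c b"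
    and n: "1 \<le> n" "n \<le> 2 * N"
  defines "A \<equiv> (\<lambda>f x. norm (f x)) ` {f \<in> X. (\<integral>x. norm (f x) powr q \<partial>\<mu>) \<le> 1}"
  shows "\<exists>T. finite T \<and> T \<noteq> {} \<and> T \<subseteq> A \<and>
    ln (card T) \<le> (if dyadic_level j \<le> 2 * B / net_scale q
      then 2 * real N * coarse_exponent q * log 2 (2 * B * N)
      else real N * (2 * B / (net_scale q * dyadic_level j)) powr q + 1) \<and>
    (\<forall>f\<in>A. \<exists>g\<in>T. \<forall>x\<in>space \<mu>. \<bar>f x - g x\<bar> \<le> net_scale q * dyadic_level j)"
proof -
  define a where "a = net_scale q"
  have a: "0 < a" "a \<le> 1" using net_scale_bounds[OF q] by (auto simp: a_def)
  have N: "1 \<le> N" and B: "1 \<le> B" and sets: "sets \<mu> = sets (restrict_space borel \<Omega>)"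
    and X: "X \<subseteq> cont_functions \<Omega>" and compact: "compact \<Omega>"
    and ent: "\<And>k. k \<in> {1..N} \<Longrightarrow> entropy_number k (Lq_unit_ball \<mu> q X) (cont_functions \<Omega>) (sup_norm \<Omega>)
                   \<le> ereal (B * (real N / real k) powr (1 / q))"
    using set compactin_Euclidean_space_imp_compact unfolding entropy_setting_def by blast+
  have space: "space \<mu> = \<Omega>" using sets_eq_imp_space_eq[OF sets] by (simp add: space_restrict_space)
  let ?A = "{f \<in> X. (\<integral>x. norm (f x) powr q \<partial>\<mu>) \<le> 1}"
  have unit_ball: "Lq_unit_ball \<mu> q X = ?A"
  proof -
    have "(\<integral>x. norm (f x) powr q \<partial>\<mu>) powr (1 / q) \<le> 1 \<longleftrightarrow> (\<integral>x. norm (f x) powr q \<partial>\<mu>) \<le> 1" for f :: "_ \<Rightarrow> 'k"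
    proof
      assume "(\<integral>x. norm (f x) powr q \<partial>\<mu>) powr (1 / q) \<le> 1"
      then have "((\<integral>x. norm (f x) powr q \<partial>\<mu>) powr (1 / q)) powr q \<le> 1" using q by (intro powr_le1) auto
      then show "(\<integral>x. norm (f x) powr q \<partial>\<mu>) \<le> 1" using q by (simp add: powr_powr)
    qed (use q in \<open>auto intro!: powr_le1\<close>)
    then show ?thesis by (simp add: Lq_unit_ball_def Lq_norm_def)
  qed
  define K where "K = 4 * B * real N powr (1 / q)"
  interpret real_function_space \<mu> X q K
    unfolding K_def by (rule entropy_setting_real_function_space[OF q set])
  show ?thesis
  proof (cases "dyadic_level j \<le> 2 * B / a")
    case True
    \<comment> \<open>One mesh, that of the lowest level, serves every crude level: refining it
      changes only a constant inside the logarithm.\<close>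
    obtain S where S: "finite S" "S \<subseteq> ?A" "real (card S) \<le> (2 * K * (K powr q)\<^sup>2 * n / (a / 16) + 3) ^ n"
      "\<And>f. f \<in> ?A \<Longrightarrow> \<exists>g\<in>S. \<forall>x\<in>space \<mu>. norm (f x - g x) \<le> a / 16"
      using exists_finite_net[OF b span n(1), of "a / 16"] a by auto
    let ?c = "2 * K * (K powr q)\<^sup>2 * n / (a / 16) + 3"
    have c3: "3 \<le> ?c" using K_ge_1 a by simp
    have "card S \<noteq> 0" using S(1) S(4)[of "\<lambda>x. 0"] zero_mem by auto
    then have "ln (card S) \<le> ln (?c ^ n)" using S(3) c3 by (subst ln_le_cancel_iff) auto
    also have "\<dots> = n * ln ?c" by (rule ln_realpow)
    also have "\<dots> \<le> (2 * real N) * ln ?c"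
      using n(2) c3 by (intro mult_right_mono ln_ge_zero) linarith+
    also have "\<dots> \<le> (2 * real N) * (coarse_exponent q * log 2 (2 * B * N))"
      using ln_net_bound[OF q a B N n(2)]
      by (intro mult_left_mono) (auto simp: coarse_exponent_def a_def K_def)
    finally have card: "ln (card S) \<le> 2 * real N * coarse_exponent q * log 2 (2 * B * N)" by (simp add: mult.assoc)
    have le: "a / 16 \<le> a * dyadic_level j"
      using a one_le_power[of "2::real" j] by (simp add: dyadic_level_def)
    have cover: "\<exists>g\<in>S. \<forall>x\<in>space \<mu>. norm (f x - g x) \<le> a * dyadic_level j"
      if f: "f \<in> X" "(\<integral>x. norm (f x) powr q \<partial>\<mu>) \<le> 1" for f
    proof -
      obtain g where "g \<in> S" "\<And>x. x \<in> space \<mu> \<Longrightarrow> norm (f x - g x) \<le> a / 16"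
        using S(4)[of f] f by blast
      then show ?thesis by (intro bexI[of _ g] ballI order_trans[OF _ le])
    qed
    show ?thesis
      unfolding A_def a_def[symmetric] if_P[OF True] by (rule exists_norm_net[OF S(1,2) card cover])
  next
    case False
    define t where "t = dyadic_level j"
    have t: "0 < t" by (simp add: t_def)
    define y where "y = 2 * B / (a * t)"
    have "2 * B < a * t" using False a by (simp add: t_def not_le pos_divide_less_eq mult.commute)
    then have y: "0 < y" "y \<le> 1" using a B t by (auto simp: y_def)
    \<comment> \<open>The choice makes \<open>B * (N / k) powr (1 / q)\<close> at most
      \<open>B / y = a * t / 2\<close>, half the mesh. As \<open>y \<le> 1\<close>, the index stays
      within \<open>{1..N}\<close>.\<close>
    define k where "k = nat \<lceil>N * y powr q\<rceil>"
    have "0 < N * y powr q" using N y by simp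
    then have k: "1 \<le> k" "N * y powr q \<le> k" "k \<le> N * y powr q + 1" unfolding k_def by linarith+
    have "y powr q \<le> 1" using y q by (intro powr_le1) auto
    then have "N * y powr q \<le> N" by (simp add: mult_left_le)
    then have kN: "k \<in> {1..N}" using k(1) unfolding k_def by (auto simp: nat_le_iff ceiling_le_iff)
    have "N / k \<le> 1 / y powr q" using k y by (simp add: divide_le_eq le_divide_eq field_simps)
    then have "(N / k) powr (1 / q) \<le> (1 / y powr q) powr (1 / q)"
      using q by (intro powr_mono2) auto
    also have "\<dots> = 1 / y" using y q by (simp add: powr_divide powr_powr)
    finally have "B * (N / k) powr (1 / q) \<le> B * (1 / y)" using B by (intro mult_left_mono) auto
    also have "\<dots> = a * t / 2" using a t B by (simp add: y_def)
    also have "\<dots> < a * t" using a t by simp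
    finally have lt: "B * (N / k) powr (1 / q) < a * t" .
    obtain S where S: "finite S" "S \<subseteq> ?A" "card S \<le> 2 ^ k" "\<And>g. g \<in> ?A \<Longrightarrow> \<exists>f\<in>S. sup_norm \<Omega> (f - g) \<le> a * t"
      using entropy_number_cover[OF ent[OF kN] lt] unfolding unit_ball by blast
    have cover: "\<exists>g\<in>S. \<forall>x\<in>space \<mu>. norm (f x - g x) \<le> a * t" if f: "f \<in> ?A" for f
    proof -
      obtain g where g: "g \<in> S" "sup_norm \<Omega> (g - f) \<le> a * t" using S(4)[OF f] by blast
      have gf: "g - f \<in> cont_functions \<Omega>" using f g S(2) X by (intro cont_functions_diff) auto
      have "norm (f x - g x) \<le> a * t" if "x \<in> space \<mu>" for x
        using norm_le_sup_norm[OF compact gf, of x] g(2) that by (simp add: space norm_minus_commute)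
      then show ?thesis using g(1) by blast
    qed
    have "card S \<noteq> 0" using S(1) cover[of "\<lambda>x. 0"] zero_mem by auto
    then have "ln (card S) \<le> ln (2 ^ k)"
      using S(3) by (subst ln_le_cancel_iff) (auto simp flip: of_nat_le_iff)
    also have "\<dots> = k * ln 2" by (simp add: ln_realpow)
    also have "\<dots> \<le> k" using ln_2_less_1 by (simp add: mult_left_le)
    finally have "ln (card S) \<le> N * y powr q + 1" using k by linarith
    then have card: "ln (card S) \<le> N * (2 * B / (a * dyadic_level j)) powr q + 1"
      by (simp add: y_def t_def)
    show ?thesis
      unfolding A_def a_def[symmetric] if_not_P[OF False]
      by (rule exists_norm_net[OF S(1,2) card]) (use cover in \<open>simp add: t_def\<close>)
  qed
qed

lemma entropy_setting_discretization:
  fixes X :: "((nat \<Rightarrow> real) \<Rightarrow> 'k::{real_normed_field, euclidean_space}) set"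
  assumes q: "1 \<le> q" and set: "entropy_setting q d \<Omega> \<mu> X N B"
    and b: "\<And>i. i < n \<Longrightarrow> b i \<in> X" and span: "\<And>f. f \<in> X \<Longrightarrow> \<exists>c. f = lincomb n c b"
    and n: "1 \<le> n" "n \<le> 2 * N"
  shows "\<exists>m::nat. m \<ge> 1 \<and> real m \<le> (7168 * budget_constant q + 1) * real N * B powr q * (log 2 (2 * B * real N))\<^sup>2 \<and>
        (\<exists>\<xi> :: nat \<Rightarrow> nat \<Rightarrow> real. (\<forall>j\<in>{1..m}. \<xi> j \<in> \<Omega>) \<and>
          (\<forall>f\<in>X. 1 / 2 * Lq_norm \<mu> q f powr q \<le> 1 / real m * (\<Sum>j=1..m. norm (f (\<xi> j)) powr q) \<and>
                  1 / real m * (\<Sum>j=1..m. norm (f (\<xi> j)) powr q) \<le> 3 / 2 * Lq_norm \<mu> q f powr q))"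
proof -
  have N: "1 \<le> N" and B: "1 \<le> B" and sets: "sets \<mu> = sets (restrict_space borel \<Omega>)"
    using set unfolding entropy_setting_def by blast+
  have space: "space \<mu> = \<Omega>" using sets_eq_imp_space_eq[OF sets] by (simp add: space_restrict_space)
  define K where "K = 4 * B * real N powr (1 / q)"
  interpret real_function_space \<mu> X q K
    unfolding K_def by (rule entropy_setting_real_function_space[OF q set])
  let ?I = "\<lambda>f :: _ \<Rightarrow> 'k. expectation (\<lambda>x. norm (f x) powr q)"
  define A where "A = (\<lambda>f x. norm (f x)) ` {f \<in> X. ?I f \<le> 1}"
  define L where "L = log 2 (2 * B * real N)"
  have rN: "1 \<le> real N" using N by simp
  have BN: "1 \<le> B * real N" using B rN mult_mono[of 1 B 1 "real N"] by simp
  have "L = 1 + log 2 (B * real N)"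
    using B N by (simp add: L_def mult.assoc log_mult)
  moreover have "0 \<le> log 2 (B * real N)" using BN by simp
  ultimately have L: "L = 1 + log 2 (B * real N)" "1 \<le> L" by linarith+
  \<comment> \<open>The first level reaching \<open>K\<close>, the uniform bound on the unit ball;
    rounding up keeps it below \<open>2 * K\<close>.\<close>
  define J where "J = nat \<lceil>log 2 (16 * K)\<rceil>"
  have logK: "4 \<le> log 2 (16 * K)" using K_ge_1 by (simp add: le_log_iff powr_numeral)
  then have J: "1 \<le> J" "log 2 (16 * K) \<le> J" "J \<le> log 2 (16 * K) + 1" unfolding J_def by linarith+
  have level_J: "dyadic_level J = 2 powr J / 16" by (simp add: dyadic_level_def powr_realpow)
  have "16 * K \<le> 2 powr J" using J(2) K_ge_1 by (simp add: log_le_iff)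
  then have K_le: "K \<le> dyadic_level J" by (simp add: level_J)
  have "2 powr J \<le> 2 powr (log 2 (16 * K) + 1)" using J(3) by simp
  also have "\<dots> = 32 * K" using K_ge_1 by (simp add: powr_add)
  finally have "dyadic_level J \<le> 2 * K" by (simp add: level_J)
  then have "dyadic_level J powr q \<le> (2 * K) powr q" using q by (intro powr_mono2) auto
  also have "\<dots> = 8 powr q * (N * B powr q)"
  proof -
    have "2 * K = 8 * B * real N powr (1 / q)" by (simp add: K_def)
    then show ?thesis using B q by (simp add: powr_mult powr_powr)
  qed
  finally have JNB: "dyadic_level J powr q \<le> 8 powr q * (N * B powr q)" .
  \<comment> \<open>With 6 from \<open>log 2 64\<close> and 1 from rounding, \<open>J\<close> is at
    most \<open>7 + log 2 (B * N)\<close>, and \<open>L\<close> is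
    \<open>1 + log 2 (B * N)\<close>.\<close>
  have "16 * K \<le> 64 * (B * real N)"
    using B rN q powr_mono[of "1 / q" 1 "real N"] by (simp add: K_def)
  then have "log 2 (16 * K) \<le> log 2 (64 * (B * real N))" using K_ge_1 by simp
  also have "\<dots> = 6 + log 2 (B * real N)"
  proof -
    have "log 2 64 = (6 :: real)" using log_pow_cancel[of "2::real" 6] by simp
    then show ?thesis using BN by (subst log_mult) auto
  qed
  finally have J7: "J \<le> 7 * L" using J(3) L by linarith
  define m where "m = nat \<lceil>7168 * budget_constant q * (N * B powr q) * L\<^sup>2\<rceil>"
  have "1 * 1 * 1 \<le> N * B powr q * L\<^sup>2"
    using rN B q L by (intro mult_mono ge_one_powr_ge_zero one_le_power) auto
  then have NBL: "1 \<le> N * B powr q * L\<^sup>2" by simp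
  have E: "1 \<le> budget_constant q" by (rule budget_constant_ge_1[OF q])
  have "1 * 1 \<le> 7168 * budget_constant q * (N * B powr q * L\<^sup>2)"
    using E NBL by (intro mult_mono) auto
  then have m: "1 \<le> m" "7168 * budget_constant q * (N * B powr q) * L\<^sup>2 \<le> m"
      "m \<le> 7168 * budget_constant q * (N * B powr q) * L\<^sup>2 + 1"
    unfolding m_def mult.assoc by linarith+
  have "\<forall>j. \<exists>T. finite T \<and> T \<noteq> {} \<and> T \<subseteq> A \<and>
    ln (card T) \<le> (if dyadic_level j \<le> 2 * B / net_scale q
      then 2 * real N * coarse_exponent q * L
      else real N * (2 * B / (net_scale q * dyadic_level j)) powr q + 1) \<and>
    (\<forall>f\<in>A. \<exists>g\<in>T. \<forall>x\<in>space \<mu>. \<bar>f x - g x\<bar> \<le> net_scale q * dyadic_level j)"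
    unfolding A_def L_def by (intro allI entropy_setting_nets[where b = b, OF q set _ _ n] b span)
  then obtain net where net: "\<And>j. finite (net j)" "\<And>j. net j \<noteq> {}" "\<And>j. net j \<subseteq> A"
    "\<And>j. ln (card (net j)) \<le> (if dyadic_level j \<le> 2 * B / net_scale q
      then 2 * real N * coarse_exponent q * L
      else real N * (2 * B / (net_scale q * dyadic_level j)) powr q + 1)"
    "\<And>j f. f \<in> A \<Longrightarrow> \<exists>g\<in>net j. \<forall>x\<in>space \<mu>. \<bar>f x - g x\<bar> \<le> net_scale q * dyadic_level j"
    by metis
  have "\<exists>\<xi>. (\<forall>i\<in>{1..m}. \<xi> i \<in> space \<mu>) \<and>
    (\<forall>f\<in>A. let S = 1 / real m * (\<Sum>i=1..m. f (\<xi> i) powr q); E = expectation (\<lambda>x. f x powr q)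
      in \<bar>S - E\<bar> \<le> (S + E) / 16 + 3 / 16)"
  proof (rule discretization_from_nets[OF q J(1) m(1), where l = "1 / (32 * real J)" and net = net])
    show "0 < 1 / (32 * real J)" "1 / (32 * real J) \<le> 1" using J(1) by auto
    show "f \<in> borel_measurable \<mu>" if "f \<in> A" for f
    proof -
      obtain f' where f': "f = (\<lambda>x. norm (f' x))" "f' \<in> X" using \<open>f \<in> A\<close> by (auto simp: A_def)
      note [measurable] = meas[OF f'(2)]
      show ?thesis unfolding f'(1) by measurable
    qed
    show "0 \<le> f x \<and> f x \<le> dyadic_level J" if "f \<in> A" "x \<in> space \<mu>" for f x
    proof -
      obtain f' where f': "f = (\<lambda>x. norm (f' x))" "f' \<in> X" "?I f' \<le> 1" using \<open>f \<in> A\<close> by (auto simp: A_def)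
      have "?I f' powr (1 / q) \<le> 1" using f'(3) q by (intro powr_le1) auto
      then have "K * ?I f' powr (1 / q) \<le> K" using K_ge_1 by (simp add: mult_left_le)
      then show ?thesis using norm_le[OF f'(2) that(2)] K_le unfolding f'(1) by auto
    qed
    show "expectation (\<lambda>x. f x powr q) \<le> 1" if "f \<in> A" for f using that by (auto simp: A_def)
    show "finite (net j) \<and> net j \<noteq> {} \<and> net j \<subseteq> A" for j using net by blast
    show "\<exists>g\<in>net j. \<forall>x\<in>space \<mu>. \<bar>f x - g x\<bar> \<le> 1 / (32 * q * 4 powr q) * dyadic_level j"
      if "f \<in> A" for f j
      using net(5)[OF that] by (simp add: net_scale_def)
    show "(\<Sum>j=1..J. 1 / (32 * real J) + dyadic_level j powr q * ln (2 * real J * real (card (net j))) /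
        (real m * (1 / (32 * real J)))) \<le> 1 / 16"
    proof (rule chaining_budget[OF q B N L(2) J(1) J7 JNB _ _ m(2)])
      show "1 \<le> real (card (net j))" for j
        using net(1,2)[of j] by (simp add: Suc_le_eq card_gt_0_iff)
    qed (rule net(4))
  qed
  then obtain \<xi> where \<xi>: "\<And>i. i \<in> {1..m} \<Longrightarrow> \<xi> i \<in> space \<mu>"
    and disc: "\<And>f. f \<in> A \<Longrightarrow> \<bar>1 / real m * (\<Sum>i=1..m. f (\<xi> i) powr q) - expectation (\<lambda>x. f x powr q)\<bar>
      \<le> (1 / real m * (\<Sum>i=1..m. f (\<xi> i) powr q) + expectation (\<lambda>x. f x powr q)) / 16 + 3 / 16"
    unfolding Let_def by blast
  have "1 / 2 * ?I f \<le> 1 / real m * (\<Sum>j=1..m. norm (f (\<xi> j)) powr q) \<and>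
      1 / real m * (\<Sum>j=1..m. norm (f (\<xi> j)) powr q) \<le> 3 / 2 * ?I f" if f: "f \<in> X" for f
  proof (cases "?I f = 0")
    case True
    then have "f = (\<lambda>x. 0)" by (rule eq_zero[OF f])
    then show ?thesis using True by simp
  next
    case False
    have "0 \<le> ?I f" by simp
    with False have I: "0 < ?I f" by linarith
    define s where "s = 1 / ?I f powr (1 / q)"
    have s: "0 < s" "s powr q = 1 / ?I f" using I q by (auto simp: s_def powr_divide powr_powr)
    define g where "g = (\<lambda>x. norm (s *\<^sub>R f x))"
    have gq: "g x powr q = norm (f x) powr q / ?I f" for x
      using s by (simp add: g_def powr_mult)
    then have Ig: "expectation (\<lambda>x. g x powr q) = 1" using I by simp
    then have gA: "g \<in> A" unfolding A_def g_def by (intro image_eqI[OF refl]) (simp add: scale_mem[OF f])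
    define S where "S = 1 / real m * (\<Sum>j=1..m. norm (f (\<xi> j)) powr q)"
    have Sg: "1 / real m * (\<Sum>i=1..m. g (\<xi> i) powr q) = S / ?I f"
      by (simp add: gq S_def sum_divide_distrib[symmetric])
    \<comment> \<open>Solving for \<open>z\<close> gives the slightly better range from
      \<open>12 / 17\<close> to \<open>4 / 3\<close>.\<close>
    have "1 / 2 \<le> z \<and> z \<le> 3 / 2" if "\<bar>z - 1\<bar> \<le> (z + 1) / 16 + 3 / 16" for z :: real
      using that unfolding abs_le_iff add_divide_distrib by auto
    with disc[OF gA] have "1 / 2 \<le> S / ?I f" "S / ?I f \<le> 3 / 2" unfolding Ig Sg by blast+
    then show ?thesis unfolding S_def[symmetric] using I by (simp add: pos_le_divide_eq pos_divide_le_eq)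
  qed
  moreover have "Lq_norm \<mu> q f powr q = ?I f" for f
    using q by (simp add: Lq_norm_def powr_powr)
  \<comment> \<open>The 1 lost in rounding \<open>m\<close> up is absorbed because
    \<open>N * B powr q * L\<^sup>2\<close> is at least 1.\<close>
  moreover have "real m \<le> (7168 * budget_constant q + 1) * real N * B powr q * L\<^sup>2"
    using m(3) NBL by (simp add: algebra_simps)
  ultimately show ?thesis using m(1) \<xi> unfolding L_def space by (intro exI[of _ m] conjI exI[of _ \<xi>]) auto
qed

section \<open>Generators over the reals for both scalar fields\<close>

lemma finite_basis:
  fixes X :: "('a \<Rightarrow> 'k::field) set"
  assumes X: "fun_vs.subspace X" and dim: "fun_vs.dim X = N" "1 \<le> N"
  obtains b where "\<And>i. i < N \<Longrightarrow> b i \<in> X" "\<And>f. f \<in> X \<Longrightarrow> \<exists>c. f = (\<lambda>x. \<Sum>i<N. c i * b i x)"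
proof -
  obtain S where S: "S \<subseteq> X" "X \<subseteq> fun_vs.span S" "card S = N"
    using fun_vs.basis_exists[of X] dim(1) by metis
  \<comment> \<open>An infinite set has cardinality 0 by convention, so \<open>N \<ge> 1\<close>
    rules out infinite dimension.\<close>
  then have fin: "finite S" using dim(2) by (metis card.infinite not_one_le_zero)
  obtain b where b: "bij_betw b {..<N} S"
    using ex_bij_betw_nat_finite[OF fin] S(3) by (auto simp: atLeast0LessThan)
  show thesis
  proof (rule that)
    show "b i \<in> X" if "i < N" for i using bij_betwE[OF b] that S(1) by auto
    fix f assume "f \<in> X"
    then have "f \<in> range (\<lambda>u. \<Sum>v\<in>S. fun_scale (u v) v)"
      using S(2) fun_vs.span_finite[OF fin] by auto
    then obtain u where "f = (\<Sum>v\<in>S. fun_scale (u v) v)" by blast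
    also have "\<dots> = (\<Sum>i<N. fun_scale (u (b i)) (b i))"
      by (rule sum.reindex_bij_betw[OF b, symmetric])
    also have "\<dots> = (\<lambda>x. \<Sum>i<N. u (b i) * b i x)"
    proof
      show "(\<Sum>i<N. fun_scale (u (b i)) (b i)) x = (\<Sum>i<N. u (b i) * b i x)" for x
        by (induction N) (auto simp: fun_scale_def zero_fun_def)
    qed
    finally show "\<exists>c. f = (\<lambda>x. \<Sum>i<N. c i * b i x)" by (intro exI[of _ "\<lambda>i. u (b i)"])
  qed
qed

theorem theorem1p3:
  fixes q :: real
  assumes "1 \<le> q"
  shows "\<exists>C>0.
    (\<forall>d \<Omega> \<mu> (X :: ((nat \<Rightarrow> real) \<Rightarrow> real) set) N B. entropy_setting q d \<Omega> \<mu> X N B \<longrightarrow>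
      (\<exists>m::nat. m \<ge> 1 \<and> real m \<le> C * real N * B powr q * (log 2 (2 * B * real N))\<^sup>2 \<and>
        (\<exists>\<xi> :: nat \<Rightarrow> nat \<Rightarrow> real. (\<forall>j\<in>{1..m}. \<xi> j \<in> \<Omega>) \<and>
          (\<forall>f\<in>X. 1 / 2 * Lq_norm \<mu> q f powr q \<le> 1 / real m * (\<Sum>j=1..m. norm (f (\<xi> j)) powr q) \<and>
                  1 / real m * (\<Sum>j=1..m. norm (f (\<xi> j)) powr q) \<le> 3 / 2 * Lq_norm \<mu> q f powr q)))) \<and>
    (\<forall>d \<Omega> \<mu> (X :: ((nat \<Rightarrow> real) \<Rightarrow> complex) set) N B. entropy_setting q d \<Omega> \<mu> X N B \<longrightarrow>
      (\<exists>m::nat. m \<ge> 1 \<and> real m \<le> C * real N * B powr q * (log 2 (2 * B * real N))\<^sup>2 \<and>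
        (\<exists>\<xi> :: nat \<Rightarrow> nat \<Rightarrow> real. (\<forall>j\<in>{1..m}. \<xi> j \<in> \<Omega>) \<and>
          (\<forall>f\<in>X. 1 / 2 * Lq_norm \<mu> q f powr q \<le> 1 / real m * (\<Sum>j=1..m. norm (f (\<xi> j)) powr q) \<and>
                  1 / real m * (\<Sum>j=1..m. norm (f (\<xi> j)) powr q) \<le> 3 / 2 * Lq_norm \<mu> q f powr q))))"
proof (intro exI[of _ "7168 * budget_constant q + 1"] conjI allI impI)
  show "0 < 7168 * budget_constant q + 1" using budget_constant_ge_1[OF assms] by linarith
next
  fix d \<Omega> \<mu> and X :: "((nat \<Rightarrow> real) \<Rightarrow> real) set" and N B
  assume set: "entropy_setting q d \<Omega> \<mu> X N B"
  then have X: "fun_vs.subspace X" "fun_vs.dim X = N" "1 \<le> N" by (auto simp: entropy_setting_def)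
  obtain b where b: "\<And>i. i < N \<Longrightarrow> b i \<in> X" "\<And>f. f \<in> X \<Longrightarrow> \<exists>c. f = (\<lambda>x. \<Sum>i<N. c i * b i x)"
    using finite_basis[OF X] by blast
  show "\<exists>m\<ge>1. real m \<le> (7168 * budget_constant q + 1) * real N * B powr q * (log 2 (2 * B * real N))\<^sup>2 \<and>
        (\<exists>\<xi>. (\<forall>j\<in>{1..m}. \<xi> j \<in> \<Omega>) \<and>
          (\<forall>f\<in>X. 1 / 2 * Lq_norm \<mu> q f powr q \<le> 1 / real m * (\<Sum>j=1..m. norm (f (\<xi> j)) powr q) \<and>
                  1 / real m * (\<Sum>j=1..m. norm (f (\<xi> j)) powr q) \<le> 3 / 2 * Lq_norm \<mu> q f powr q))"
  proof (rule entropy_setting_discretization[OF assms set])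
    show "\<exists>c. f = lincomb N c b" if "f \<in> X" for f using b(2)[OF that] by (simp add: lincomb_def)
  qed (use b X in auto)
next
  fix d \<Omega> \<mu> and X :: "((nat \<Rightarrow> real) \<Rightarrow> complex) set" and N B
  assume set: "entropy_setting q d \<Omega> \<mu> X N B"
  then have X: "fun_vs.subspace X" "fun_vs.dim X = N" "1 \<le> N" by (auto simp: entropy_setting_def)
  obtain b where b: "\<And>i. i < N \<Longrightarrow> b i \<in> X" "\<And>f. f \<in> X \<Longrightarrow> \<exists>c. f = (\<lambda>x. \<Sum>i<N. c i * b i x)"
    using finite_basis[OF X] by blast
  \<comment> \<open>A complex basis together with its multiples by \<open>\<i>\<close> generates
    \<open>X\<close> over the reals; the real and imaginary parts of a coefficient go to the two
    halves.\<close>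
  define b' where "b' i = (if i < N then b i else fun_scale \<i> (b (i - N)))" for i
  have split: "(\<Sum>i<2 * N. g i) = (\<Sum>i<N. g i) + (\<Sum>i<N. g (i + N))" for g :: "nat \<Rightarrow> complex"
    using sum.atLeastLessThan_concat[of 0 N "2 * N" g] sum.shift_bounds_nat_ivl[of g 0 N N]
    by (simp add: atLeast0LessThan mult_2)
  show "\<exists>m\<ge>1. real m \<le> (7168 * budget_constant q + 1) * real N * B powr q * (log 2 (2 * B * real N))\<^sup>2 \<and>
        (\<exists>\<xi>. (\<forall>j\<in>{1..m}. \<xi> j \<in> \<Omega>) \<and>
          (\<forall>f\<in>X. 1 / 2 * Lq_norm \<mu> q f powr q \<le> 1 / real m * (\<Sum>j=1..m. norm (f (\<xi> j)) powr q) \<and>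
                  1 / real m * (\<Sum>j=1..m. norm (f (\<xi> j)) powr q) \<le> 3 / 2 * Lq_norm \<mu> q f powr q))"
  proof (rule entropy_setting_discretization[OF assms set])
    show "b' i \<in> X" if "i < 2 * N" for i
      using that b(1) fun_vs.subspace_scale[OF X(1)] by (auto simp: b'_def)
    show "\<exists>c. f = lincomb (2 * N) c b'" if f: "f \<in> X" for f
    proof -
      obtain c where c: "f = (\<lambda>x. \<Sum>i<N. c i * b i x)" using b(2)[OF f] by blast
      define c' where "c' i = (if i < N then Re (c i) else Im (c (i - N)))" for i
      have "f x = lincomb (2 * N) c' b' x" for x
      proof -
        have "f x = (\<Sum>i<N. Re (c i) *\<^sub>R b i x + Im (c i) *\<^sub>R (\<i> * b i x))"
          unfolding c
          by (intro sum.cong refl) (simp add: complex_eq_iff)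
        then show ?thesis
          by (simp add: lincomb_def split sum.distrib c'_def b'_def fun_scale_def)
      qed
      then show ?thesis by blast
    qed
  qed (use X in auto)
qed

end
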